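(* Let $U=U_q\mathfrak{gl}(2\vert1)^\sigma$, let $V_\alpha$ be its $4$-dimensional representation with parameter $\alpha\neq 0,-1$, and let $\mathcal{B}_\alpha$ be the basis of $V_\alpha\otimes V_\alpha^*$ formed by the following 16 vectors, where $v=e_1\otimes e_1^*$: $$v,\ E^2_3v,\ E^1_3v,\ E^3_1v,\ E^3_2v,\ E^2_3E^1_3v,\ E^2_3E^3_1v,\ E^2_3E^3_2v,\ E^1_3E^3_1v,\ E^1_3E^3_2v,\ E^3_1E^3_2v,\ E^1_3E^3_1E^3_2v,\ E^2_3E^3_1E^3_2v,\ E^2_3E^1_3E^3_2v,\ E^2_3E^1_3E^3_1v,\ E^2_3E^1_3E^3_1E^3_2v.$$ Then for every $X\in U$, the coefficients of the matrix representing the action of $X$ on $V_\alpha\otimes V_\alpha^*$ in the basis $\mathcal{B}_\alpha$ belong to $\mathbb{C}(q)$ (rather than merely to $\mathbb{C}(q,q^\alpha)$); that is, they do not depend on $q^\alpha$.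
   Context: Here $q$ is generic, $q^\alpha$ is treated as an independent variable, square roots $q^{1/2},q^{\alpha/2}$ are chosen where needed, and $[x]_q=\frac{q^x-q^{-x}}{q-q^{-1}}$. The superalgebra $U_q\mathfrak{gl}(2\vert1)$ is generated by invertible commuting even elements $q^{E^1_1},q^{E^2_2},q^{E^3_3}$, even elements $E^1_2,E^2_1$, odd elements $E^2_3,E^3_2$, with (for $E^b_{b\pm1}$ a generator) $q^{E^a_a}E^b_{b\pm1}q^{-E^a_a}=q^{\delta^a_b-\delta^a_{b\pm1}}E^b_{b\pm1}$; $(E^3_2)^2=(E^2_3)^2=0$; $E^1_2E^3_2=E^3_2E^1_2$; $E^2_1E^2_3=E^2_3E^2_1$; $E^1_2E^2_1=[E^1_1-E^2_2]_q+E^2_1E^1_2$; $E^2_3E^3_2=[E^2_2+E^3_3]_q-E^3_2E^2_3$; and, setting $E^1_3=E^1_2E^2_3-q^{-1}E^2_3E^1_2$ and $E^3_1=E^3_2E^2_1-qE^2_1E^3_2$, the Serre relations $E^1_2E^1_3=qE^1_3E^1_2$ and $E^3_1E^2_1=q^{-1}E^2_1E^3_1$. The bosonization $U=U_q\mathfrak{gl}(2\vert1)^\sigma$ is the Hopf algebra obtained by adjoining $\sigma$ with $\sigma^2=1$ and $\sigma x=(-1)^{[x]}x\sigma$ for homogeneous $x$ of parity $[x]$. Its coproduct is: $\sigma$ and $q^{E^i_i}$ are group-like; for $x\in\{E^1_2,E^2_1\}$ and $h=E^1_1-E^2_2$, $\Delta(x)=x\otimes q^{-h/2}+q^{h/2}\otimes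 x$; for $x\in\{E^2_3,E^3_2\}$ and $h=E^2_2+E^3_3$, $\Delta(x)=x\otimes q^{-h/2}+q^{h/2}\sigma\otimes x$. (Square roots $q^{\pm E^i_i/2}$ are used in these formulas.) The antipode $S$ is the algebra antihomomorphism with $S(q^{E^i_i})=q^{-E^i_i}$, $S(\sigma)=\sigma$, $S(E^1_2)=-q^{-1}E^1_2$, $S(E^2_1)=-qE^2_1$, $S(E^2_3)=-\sigma E^2_3$, $S(E^3_2)=-\sigma E^3_2$. $U$ is generated by $\sigma,q^{\pm E^1_1},q^{\pm E^2_2},q^{\pm E^3_3},E^1_2,E^2_1,E^2_3,E^3_2$. $V_\alpha$ has basis $e_1,e_2,e_3,e_4$ and action (unlisted images are zero): $q^{E^1_1}=\mathrm{diag}(1,1,q^{-1},q^{-1})$, $q^{E^2_2}=\mathrm{diag}(1,q^{-1},1,q^{-1})$, $q^{E^3_3}=\mathrm{diag}(q^\alpha,q^{\alpha+1},q^{\alpha+1},q^{\alpha+2})$, $\sigma=\mathrm{diag}(1,-1,-1,1)$; $E^1_2e_3=-e_2$; $E^2_1e_2=-e_3$; $E^2_3e_2=e_1$, $E^2_3e_4=e_3$; $E^3_2e_1=[\alpha]_qe_2$, $E^3_2e_3=[\alpha+1]_qe_4$. The dual $V_\alpha^*$ (dual basis $e_i^*$) carries the action $(x\cdot f)(w)=f(S(x)w)$, and $U$ acts on $V_\alpha\otimes V_\alpha^*$ through the coproduct. *)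

theory Defs
  imports "HOL-Analysis.Analysis" "HOL-Computational_Algebra.Polynomial"
    "HOL-Computational_Algebra.Fraction_Field"
begin

type_synonym Cq = "complex poly fract"

definition qv :: Cq where "qv = Fract [:0, 1:] 1"

text \<open>Noncommutative polynomial expressions in generators from \<open>'g\<close>; the algebra laws are
  imposed below, together with the defining relations, by the congruence \<open>uq_eq\<close>.\<close>

datatype 'g expr = Gen 'g | Scal Cq | Plus "'g expr" "'g expr" | Times "'g expr" "'g expr"

instantiation expr :: (type) "{zero, one, plus, times, minus, uminus}"
begin
definition "0 = Scal 0"
definition "1 = Scal 1"
definition "x + y = Plus x y"
definition "x * y = Times x y"
definition "- x = Times (Scal (- 1)) (x :: 'a expr)"
definition "x - y = Plus x (Times (Scal (- 1)) (y :: 'a expr))"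
instance ..
end

lemmas expr_defs = zero_expr_def one_expr_def plus_expr_def times_expr_def
  uminus_expr_def minus_expr_def

text \<open>\<open>QE a\<close> and \<open>QEinv a\<close> stand for \<open>q\<close> to the power \<open>\<plusminus>E\<^sup>a\<^sub>a\<close> (\<open>a = 1, 2, 3\<close>; the index type is \<open>3\<close>),
  and \<open>E12\<close> for \<open>E\<^sup>1\<^sub>2\<close>, etc.\<close>

datatype gen = SigmaG | QE 3 | QEinv 3 | E12 | E21 | E23 | E32

fun weight :: "gen \<Rightarrow> 3 \<Rightarrow> int" where
  "weight E12 a = of_bool (a = 1) - of_bool (a = 2)"
| "weight E21 a = of_bool (a = 2) - of_bool (a = 1)"
| "weight E23 a = of_bool (a = 2) - of_bool (a = 3)"
| "weight E32 a = of_bool (a = 3) - of_bool (a = 2)"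
| "weight _ a = 0"

definition E13_expr :: "gen expr" where
  "E13_expr = Gen E12 * Gen E23 - Scal (inverse qv) * (Gen E23 * Gen E12)"

definition E31_expr :: "gen expr" where
  "E31_expr = Gen E32 * Gen E21 - Scal qv * (Gen E21 * Gen E32)"

text \<open>\<open>[x]\<^sub>q\<close> for \<open>x\<close> in the span of the \<open>E\<^sup>a\<^sub>a\<close>, given expressions for \<open>q\<^sup>x\<close> and its inverse.\<close>

definition qbracket :: "gen expr \<Rightarrow> gen expr \<Rightarrow> gen expr" where
  "qbracket k k' = Scal (inverse (qv - inverse qv)) * (k - k')"

inductive uq_rel :: "gen expr \<Rightarrow> gen expr \<Rightarrow> bool" where
  "uq_rel (Gen (QE a) * Gen (QEinv a)) 1"
| "uq_rel (Gen (QEinv a) * Gen (QE a)) 1"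
| "uq_rel (Gen (QE a) * Gen (QE b)) (Gen (QE b) * Gen (QE a))"
| "x \<in> {E12, E21, E23, E32} \<Longrightarrow>
    uq_rel (Gen (QE a) * Gen x * Gen (QEinv a)) (Scal (qv powi weight x a) * Gen x)"
| "uq_rel (Gen E32 * Gen E32) 0"
| "uq_rel (Gen E23 * Gen E23) 0"
| "uq_rel (Gen E12 * Gen E32) (Gen E32 * Gen E12)"
| "uq_rel (Gen E21 * Gen E23) (Gen E23 * Gen E21)"
| "uq_rel (Gen E12 * Gen E21)
     (qbracket (Gen (QE 1) * Gen (QEinv 2)) (Gen (QEinv 1) * Gen (QE 2)) + Gen E21 * Gen E12)"
| "uq_rel (Gen E23 * Gen E32)
     (qbracket (Gen (QE 2) * Gen (QE 3)) (Gen (QEinv 2) * Gen (QEinv 3)) - Gen E32 * Gen E23)"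
| "uq_rel (Gen E12 * E13_expr) (Scal qv * (E13_expr * Gen E12))"
| "uq_rel (E31_expr * Gen E21) (Scal (inverse qv) * (Gen E21 * E31_expr))"
| "uq_rel (Gen SigmaG * Gen SigmaG) 1"
| "x \<in> {QE a, QEinv a, E12, E21} \<Longrightarrow> uq_rel (Gen SigmaG * Gen x) (Gen x * Gen SigmaG)"
| "x \<in> {E23, E32} \<Longrightarrow> uq_rel (Gen SigmaG * Gen x) (- (Gen x * Gen SigmaG))"

text \<open>The congruence generated by \<open>uq_rel\<close> and the laws of unital associative \<open>\<complex>(q)\<close>-algebras.\<close>

inductive uq_eq :: "gen expr \<Rightarrow> gen expr \<Rightarrow> bool" where
  uq_rel: "uq_rel x y \<Longrightarrow> uq_eq x y"
| uq_refl: "uq_eq x x"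
| uq_sym: "uq_eq x y \<Longrightarrow> uq_eq y x"
| uq_trans: "uq_eq x y \<Longrightarrow> uq_eq y z \<Longrightarrow> uq_eq x z"
| uq_plus_cong: "uq_eq x x' \<Longrightarrow> uq_eq y y' \<Longrightarrow> uq_eq (x + y) (x' + y')"
| uq_times_cong: "uq_eq x x' \<Longrightarrow> uq_eq y y' \<Longrightarrow> uq_eq (x * y) (x' * y')"
| uq_plus_assoc: "uq_eq (x + y + z) (x + (y + z))"
| uq_plus_comm: "uq_eq (x + y) (y + x)"
| uq_plus_zero: "uq_eq (0 + x) x"
| uq_plus_minus: "uq_eq (- x + x) 0"
| uq_times_assoc: "uq_eq (x * y * z) (x * (y * z))"
| uq_one_times: "uq_eq (1 * x) x"
| uq_times_one: "uq_eq (x * 1) x"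
| uq_distrib_right: "uq_eq ((x + y) * z) (x * z + y * z)"
| uq_distrib_left: "uq_eq (x * (y + z)) (x * y + x * z)"
| uq_scal_plus: "uq_eq (Scal (a + b)) (Scal a + Scal b)"
| uq_scal_times: "uq_eq (Scal (a * b)) (Scal a * Scal b)"
| uq_scal_central: "uq_eq (Scal a * x) (x * Scal a)"

quotient_type U = "gen expr" / uq_eq
  by (rule equivpI)
    (auto intro!: reflpI sympI transpI intro: uq_refl uq_sym uq_trans)

instantiation U :: ring
begin
lift_definition zero_U :: U is 0 .
lift_definition plus_U :: "U \<Rightarrow> U \<Rightarrow> U" is "(+)" by (rule uq_plus_cong)
lift_definition times_U :: "U \<Rightarrow> U \<Rightarrow> U" is "(*)" by (rule uq_times_cong)
lift_definition uminus_U :: "U \<Rightarrow> U" is uminus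
  unfolding uminus_expr_def times_expr_def[symmetric]
  by (intro uq_times_cong uq_refl)
definition minus_U :: "U \<Rightarrow> U \<Rightarrow> U" where "minus_U x y = x + (- y)"
instance
proof
  fix a b c :: U
  show "a + b + c = a + (b + c)" by transfer (rule uq_plus_assoc)
  show "a + b = b + a" by transfer (rule uq_plus_comm)
  show "0 + a = a" by transfer (rule uq_plus_zero)
  show "- a + a = 0" by transfer (rule uq_plus_minus)
  show "a - b = a + - b" by (rule minus_U_def)
  show "a * b * c = a * (b * c)" by transfer (rule uq_times_assoc)
  show "(a + b) * c = a * c + b * c" by transfer (rule uq_distrib_right)
  show "a * (b + c) = a * b + a * c" by transfer (rule uq_distrib_left)
qed
end

instantiation U :: monoid_mult
begin
lift_definition one_U :: U is 1 .
instance
proof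
  fix a :: U
  show "1 * a = a" by transfer (rule uq_one_times)
  show "a * 1 = a" by transfer (rule uq_times_one)
qed
end

lift_definition Ugen :: "gen \<Rightarrow> U" is Gen .
lift_definition Uscal :: "Cq \<Rightarrow> U" is Scal .

abbreviation "uE12 \<equiv> Ugen E12"
abbreviation "uE21 \<equiv> Ugen E21"
abbreviation "uE23 \<equiv> Ugen E23"
abbreviation "uE32 \<equiv> Ugen E32"

definition uE13 :: U where "uE13 = uE12 * uE23 - Uscal (inverse qv) * (uE23 * uE12)"
definition uE31 :: U where "uE31 = uE32 * uE21 - Uscal qv * (uE21 * uE32)"

text \<open>\<open>QEhalf a\<close>, \<open>QEhalfinv a\<close> are the square roots of \<open>q\<close> to the power \<open>\<plusminus>E\<^sup>a\<^sub>a\<close> that occur in the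
  coproduct formulas; they are not elements of \<open>U\<close> itself.\<close>

datatype hgen = Base gen | QEhalf 3 | QEhalfinv 3

text \<open>A list of pairs stands for the sum of the tensors \<open>a \<otimes> b\<close>. Only the values on generators are
  recorded: the coproduct is an algebra homomorphism.\<close>

fun coproduct :: "gen \<Rightarrow> (hgen expr \<times> hgen expr) list" where
  "coproduct E12 =
     [(Gen (Base E12), Gen (QEhalfinv 1) * Gen (QEhalf 2)),
      (Gen (QEhalf 1) * Gen (QEhalfinv 2), Gen (Base E12))]"
| "coproduct E21 =
     [(Gen (Base E21), Gen (QEhalfinv 1) * Gen (QEhalf 2)),
      (Gen (QEhalf 1) * Gen (QEhalfinv 2), Gen (Base E21))]"
| "coproduct E23 =
     [(Gen (Base E23), Gen (QEhalfinv 2) * Gen (QEhalfinv 3)),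
      (Gen (QEhalf 2) * Gen (QEhalf 3) * Gen (Base SigmaG), Gen (Base E23))]"
| "coproduct E32 =
     [(Gen (Base E32), Gen (QEhalfinv 2) * Gen (QEhalfinv 3)),
      (Gen (QEhalf 2) * Gen (QEhalf 3) * Gen (Base SigmaG), Gen (Base E32))]"
| "coproduct SigmaG = [(Gen (Base SigmaG), Gen (Base SigmaG))]"
| "coproduct (QE a) = [(Gen (Base (QE a)), Gen (Base (QE a)))]"
| "coproduct (QEinv a) = [(Gen (Base (QEinv a)), Gen (Base (QEinv a)))]"

fun antipode_gen :: "hgen \<Rightarrow> hgen expr" where
  "antipode_gen (Base SigmaG) = Gen (Base SigmaG)"
| "antipode_gen (Base (QE a)) = Gen (Base (QEinv a))"
| "antipode_gen (Base (QEinv a)) = Gen (Base (QE a))"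
| "antipode_gen (QEhalf a) = Gen (QEhalfinv a)"
| "antipode_gen (QEhalfinv a) = Gen (QEhalf a)"
| "antipode_gen (Base E12) = Scal (- inverse qv) * Gen (Base E12)"
| "antipode_gen (Base E21) = Scal (- qv) * Gen (Base E21)"
| "antipode_gen (Base E23) = - (Gen (Base SigmaG) * Gen (Base E23))"
| "antipode_gen (Base E32) = - (Gen (Base SigmaG) * Gen (Base E32))"

primrec antipode :: "hgen expr \<Rightarrow> hgen expr" where
  "antipode (Gen g) = antipode_gen g"
| "antipode (Scal c) = Scal c"
| "antipode (Plus x y) = Plus (antipode x) (antipode y)"
| "antipode (Times x y) = Times (antipode y) (antipode x)"

text \<open>The modules live over a field \<open>'k\<close> that extends \<open>\<complex>(q)\<close> by means of \<open>\<iota>\<close> and contains chosen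
  square roots: \<open>s\<close> stands for \<open>q\<^bsup>1/2\<^esup>\<close> and \<open>t \<noteq> 0\<close> for \<open>q\<^bsup>\<alpha>/2\<^esup>\<close>. Since \<open>\<iota>\<close> is defined on \<open>\<complex>(q)\<close>, \<open>q\<close> is
  automatically transcendental over \<open>\<complex>\<close>. The case of an independent variable \<open>q\<^sup>\<alpha>\<close> is the one where
  \<open>t\<close> is transcendental over \<open>range \<iota>\<close>.\<close>

definition field_embedding :: "(Cq \<Rightarrow> 'k::field) \<Rightarrow> bool" where
  "field_embedding \<iota> \<longleftrightarrow> \<iota> 1 = 1 \<and> (\<forall>x y. \<iota> (x + y) = \<iota> x + \<iota> y) \<and> (\<forall>x y. \<iota> (x * y) = \<iota> x * \<iota> y)"

text \<open>\<open>qnumber Q y\<close> is \<open>[x]\<^sub>q\<close> where \<open>Q = q\<close> and \<open>y = q\<^sup>x\<close>.\<close>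

definition qnumber :: "'k::field \<Rightarrow> 'k \<Rightarrow> 'k" where
  "qnumber Q y = (y - inverse y) / (Q - inverse Q)"

definition pick4 :: "'a \<Rightarrow> 'a \<Rightarrow> 'a \<Rightarrow> 'a \<Rightarrow> 4 \<Rightarrow> 'a" where
  "pick4 a b c d i = (if i = 1 then a else if i = 2 then b else if i = 3 then c else d)"

definition diag4 :: "'k::field \<Rightarrow> 'k \<Rightarrow> 'k \<Rightarrow> 'k \<Rightarrow> 'k^4^4" where
  "diag4 a b c d = (\<chi> i j. if i = j then pick4 a b c d i else 0)"

text \<open>\<open>munit c i j\<close> maps \<open>e\<^sub>j\<close> to \<open>c e\<^sub>i\<close> and the other basis vectors to \<open>0\<close>.\<close>

definition munit :: "'k::field \<Rightarrow> 4 \<Rightarrow> 4 \<Rightarrow> 'k^4^4" where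
  "munit c i j = (\<chi> k l. if k = i \<and> l = j then c else 0)"

text \<open>The diagonal matrices giving the action of the \<open>q\<close> to the power \<open>E\<^sup>a\<^sub>a\<close> on \<open>V\<^sub>\<alpha>\<close>, for \<open>r = q\<close> and
  \<open>y = q\<^sup>\<alpha>\<close>, and of their square roots, for \<open>r = q\<^bsup>1/2\<^esup>\<close> and \<open>y = q\<^bsup>\<alpha>/2\<^esup>\<close>.\<close>

definition cartan :: "'k::field \<Rightarrow> 'k \<Rightarrow> 3 \<Rightarrow> 'k^4^4" where
  "cartan r y a =
    (if a = 1 then diag4 1 1 (inverse r) (inverse r)
     else if a = 2 then diag4 1 (inverse r) 1 (inverse r)
     else diag4 y (y * r) (y * r) (y * r\<^sup>2))"

fun V_gen :: "'k::field \<Rightarrow> 'k \<Rightarrow> hgen \<Rightarrow> 'k^4^4" where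
  "V_gen s t (Base SigmaG) = diag4 1 (- 1) (- 1) 1"
| "V_gen s t (Base (QE a)) = cartan (s\<^sup>2) (t\<^sup>2) a"
| "V_gen s t (Base (QEinv a)) = cartan (inverse (s\<^sup>2)) (inverse (t\<^sup>2)) a"
| "V_gen s t (QEhalf a) = cartan s t a"
| "V_gen s t (QEhalfinv a) = cartan (inverse s) (inverse t) a"
| "V_gen s t (Base E12) = munit (- 1) 2 3"
| "V_gen s t (Base E21) = munit (- 1) 3 2"
| "V_gen s t (Base E23) = munit 1 1 2 + munit 1 3 4"
| "V_gen s t (Base E32) =
     munit (qnumber (s\<^sup>2) (t\<^sup>2)) 2 1 + munit (qnumber (s\<^sup>2) (t\<^sup>2 * s\<^sup>2)) 4 3"

primrec expr_action ::
    "(Cq \<Rightarrow> 'k::field) \<Rightarrow> ('g \<Rightarrow> 'k^'n^'n) \<Rightarrow> 'g expr \<Rightarrow> 'k^'n^'n" where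
  "expr_action \<iota> \<rho> (Gen g) = \<rho> g"
| "expr_action \<iota> \<rho> (Scal c) = mat (\<iota> c)"
| "expr_action \<iota> \<rho> (Plus x y) = expr_action \<iota> \<rho> x + expr_action \<iota> \<rho> y"
| "expr_action \<iota> \<rho> (Times x y) = expr_action \<iota> \<rho> x ** expr_action \<iota> \<rho> y"

definition V_action :: "(Cq \<Rightarrow> 'k::field) \<Rightarrow> 'k \<Rightarrow> 'k \<Rightarrow> hgen expr \<Rightarrow> 'k^4^4" where
  "V_action \<iota> s t x = expr_action \<iota> (V_gen s t) x"

text \<open>In the dual basis, \<open>f \<mapsto> (w \<mapsto> f (A w))\<close> has the transposed matrix of \<open>A\<close>.\<close>

definition Vdual_action :: "(Cq \<Rightarrow> 'k::field) \<Rightarrow> 'k \<Rightarrow> 'k \<Rightarrow> hgen expr \<Rightarrow> 'k^4^4" where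
  "Vdual_action \<iota> s t x = transpose (V_action \<iota> s t (antipode x))"

text \<open>\<open>V\<^sub>\<alpha> \<otimes> V\<^sub>\<alpha>\<^sup>*\<close> is the space of coordinate vectors indexed by pairs, \<open>axis (i, j) 1\<close> being
  \<open>e\<^sub>i \<otimes> e\<^sub>j\<^sup>*\<close>; \<open>kron A B\<close> is the matrix of \<open>A \<otimes> B\<close>.\<close>

definition kron :: "'k::field^4^4 \<Rightarrow> 'k^4^4 \<Rightarrow> 'k^(4 \<times> 4)^(4 \<times> 4)" where
  "kron A B = (\<chi> p r. A $ fst p $ fst r * B $ snd p $ snd r)"

definition VV_gen :: "(Cq \<Rightarrow> 'k::field) \<Rightarrow> 'k \<Rightarrow> 'k \<Rightarrow> gen \<Rightarrow> 'k^(4 \<times> 4)^(4 \<times> 4)" where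
  "VV_gen \<iota> s t g =
    (\<Sum>(a, b) \<leftarrow> coproduct g. kron (V_action \<iota> s t a) (Vdual_action \<iota> s t b))"

text \<open>The choice of a representing expression is immaterial, see \<open>VV_action_abs\<close> below.\<close>

definition VV_action :: "(Cq \<Rightarrow> 'k::field) \<Rightarrow> 'k \<Rightarrow> 'k \<Rightarrow> U \<Rightarrow> 'k^(4 \<times> 4)^(4 \<times> 4)" where
  "VV_action \<iota> s t X = expr_action \<iota> (VV_gen \<iota> s t) (rep_U X)"

lemma pick4_simps [simp]: "pick4 a b c d 1 = a" "pick4 a b c d 2 = b" "pick4 a b c d 3 = c"
  "pick4 a b c d 4 = d" "pick4 a b c d 0 = d"
  by (simp_all add: pick4_def)

lemma sum_munit: "(\<Sum>k\<in>UNIV. munit x i j $ m $ k * f k) = (if m = i then x * f j else 0)"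
proof -
  have "(\<Sum>k\<in>UNIV. munit x i j $ m $ k * f k) = (\<Sum>k\<in>UNIV. if k = j then (if m = i then x * f j else 0) else 0)"
    by (rule sum.cong) (auto simp: munit_def)
  then show ?thesis by (simp add: sum.delta)
qed

lemma sum_diag4: "(\<Sum>k\<in>UNIV. diag4 a b c d $ m $ k * f k) = pick4 a b c d m * f m"
proof -
  have "(\<Sum>k\<in>UNIV. diag4 a b c d $ m $ k * f k) = (\<Sum>k\<in>UNIV. if k = m then pick4 a b c d m * f m else 0)"
    by (rule sum.cong) (auto simp: diag4_def)
  then show ?thesis by (simp add: sum.delta)
qed

lemma diag4_mult: "diag4 a b c d ** diag4 a' b' c' d' = diag4 (a * a') (b * b') (c * c') (d * d')"
  by (simp add: matrix_matrix_mult_def vec_eq_iff sum_diag4) (auto simp: diag4_def pick4_def)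

lemma diag4_munit: "diag4 a b c d ** munit x i j = munit (pick4 a b c d i * x) i j"
  by (simp add: matrix_matrix_mult_def vec_eq_iff sum_diag4) (auto simp: munit_def)

lemma mat_diag4: "mat x = diag4 x x x x"
  by (auto simp: mat_def diag4_def pick4_def vec_eq_iff)

lemma transpose_diag4: "transpose (diag4 a b c d) = diag4 a b c d"
  by (simp add: diag4_def transpose_def vec_eq_iff forall_4)

lemma transpose_munit: "transpose (munit x i j) = munit x j i"
  by (auto simp: munit_def transpose_def vec_eq_iff)

lemma transpose_plus: "transpose (A + B) = transpose A + transpose (B :: 'a::semiring_1^'n^'m)"
  by (simp add: transpose_def vec_eq_iff)

lemma kron_plus: "kron (A + A') B = kron A B + kron A' B" "kron A (B + B') = kron A B + kron A B'"
  by (auto simp: kron_def vec_eq_iff algebra_simps)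

lemma kron_mult_vec: "(kron A B *v c) $ (i, j) = (\<Sum>k\<in>UNIV. \<Sum>l\<in>UNIV. A $ i $ k * B $ j $ l * c $ (k, l))"
  by (simp add: kron_def matrix_vector_mult_def sum.cartesian_product split_def)

lemma kron_mult_vec': "(kron A B *v c) $ (i, j) = (\<Sum>k\<in>UNIV. A $ i $ k * (\<Sum>l\<in>UNIV. B $ j $ l * c $ (k, l)))"
  by (simp add: kron_mult_vec sum_distrib_left mult.assoc)

lemma kron_munit_diag4: "(kron (munit x i j) (diag4 a b c d) *v w) $ (k, l) =
    (if k = i then x * pick4 a b c d l * w $ (j, l) else 0)"
  by (simp add: kron_mult_vec' sum_diag4 sum_munit)

lemma kron_diag4_munit: "(kron (diag4 a b c d) (munit x i j) *v w) $ (k, l) =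
    (if l = i then x * pick4 a b c d k * w $ (k, j) else 0)"
  by (simp add: kron_mult_vec' sum_diag4 sum_munit)

lemma kron_diag4_diag4: "(kron (diag4 a b c d) (diag4 a' b' c' d') *v w) $ (k, l) =
    pick4 a b c d k * pick4 a' b' c' d' l * w $ (k, l)"
  by (simp add: kron_mult_vec' sum_diag4)

lemma field_embedding_simps:
  assumes "field_embedding \<iota>"
  shows "\<iota> 1 = 1" "\<iota> (x + y) = \<iota> x + \<iota> y" "\<iota> (x * y) = \<iota> x * \<iota> y" "\<iota> 0 = 0" "\<iota> (- x) = - \<iota> x"
    "\<iota> (x - y) = \<iota> x - \<iota> y" "\<iota> (inverse x) = inverse (\<iota> x)" "\<iota> x = 0 \<longleftrightarrow> x = 0"
proof -
  show one: "\<iota> 1 = 1" and add: "\<iota> (x + y) = \<iota> x + \<iota> y" and mult: "\<iota> (x * y) = \<iota> x * \<iota> y" for x y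
    using assms by (auto simp: field_embedding_def)
  show zero: "\<iota> 0 = 0" using add[of 0 0] by (metis add.right_neutral add_left_cancel)
  show neg: "\<iota> (- x) = - \<iota> x" for x
    using add[of "-x" x] zero by (simp add: eq_neg_iff_add_eq_0)
  show "\<iota> (x - y) = \<iota> x - \<iota> y" using add[of x "-y"] neg by simp
  have inv: "\<iota> (inverse x) * \<iota> x = 1" if "x \<noteq> 0" for x
    using mult[of "inverse x" x] that one by simp
  show "\<iota> (inverse x) = inverse (\<iota> x)"
    for x
    using inv[of x] zero by (cases "x = 0") (auto simp: field_simps dest: inverse_unique)
  show "\<iota> x = 0 \<longleftrightarrow> x = 0" using inv[of x] zero by (cases "x = 0") auto
qed

lemma qv_square: "qv * qv \<noteq> 1" "qv \<noteq> 0"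
proof -
  show "qv * qv \<noteq> 1" by (simp add: qv_def One_fract_def eq_fract one_pCons)
  show "qv \<noteq> 0" by (simp add: qv_def Zero_fract_def eq_fract)
qed


lemma neq4: "(1::4) \<noteq> 2" "(1::4) \<noteq> 3" "(1::4) \<noteq> 4" "(2::4) \<noteq> 3" "(2::4) \<noteq> 4" "(3::4) \<noteq> 4"
   "(1::3) \<noteq> 2" "(1::3) \<noteq> 3" "(2::3) \<noteq> 3"
  by simp_all

lemma mat_vec_nth: "(mat x *v w) $ p = x * w $ p"
proof -
  have "(mat x *v w) $ p = (\<Sum>k\<in>UNIV. if k = p then x * w $ p else 0)"
    by (simp only: matrix_vector_mult_def vec_lambda_beta, rule sum.cong) (auto simp: mat_def)
  then show ?thesis by (simp add: sum.delta)
qed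

lemma matrix_zero_vec: "(0::'a::semiring_1^'n^'m) *v w = 0"
  by (simp add: matrix_vector_mult_def vec_eq_iff)

lemmas VV_gen_eval = VV_gen_def Vdual_action_def V_action_def expr_defs cartan_def mat_diag4
  diag4_mult diag4_munit transpose_diag4 transpose_munit transpose_plus matrix_add_ldistrib kron_plus

lemma VV_gen_values:
  assumes "field_embedding \<iota>" "\<iota> qv = s\<^sup>2" "s \<noteq> 0" "t \<noteq> 0"
  shows "VV_gen \<iota> s t E12 = kron (munit (- 1) 2 3) (diag4 1 s (inverse s) 1)
      + kron (diag4 1 s (inverse s) 1) (munit (inverse (s\<^sup>2)) 3 2)" (is ?E12)
    and "VV_gen \<iota> s t E21 = kron (munit (- 1) 3 2) (diag4 1 s (inverse s) 1)
      + kron (diag4 1 s (inverse s) 1) (munit (s\<^sup>2) 2 3)" (is ?E21)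
    and "VV_gen \<iota> s t E23 = kron (munit 1 1 2 + munit 1 3 4) (diag4 t t (t * s) (t * s))
      + kron (diag4 t (- t) (- t * s) (t * s)) (munit (- 1) 2 1 + munit 1 4 3)" (is ?E23)
    and "VV_gen \<iota> s t E32 =
      kron (munit (qnumber (s\<^sup>2) (t\<^sup>2)) 2 1 + munit (qnumber (s\<^sup>2) (t\<^sup>2 * s\<^sup>2)) 4 3)
         (diag4 t t (t * s) (t * s))
      + kron (diag4 t (- t) (- t * s) (t * s))
         (munit (qnumber (s\<^sup>2) (t\<^sup>2)) 1 2 + munit (- qnumber (s\<^sup>2) (t\<^sup>2 * s\<^sup>2)) 3 4)" (is ?E32)
    and "VV_gen \<iota> s t SigmaG = kron (diag4 1 (- 1) (- 1) 1) (diag4 1 (- 1) (- 1) 1)" (is ?SigmaG)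
    and "VV_gen \<iota> s t (QE a) = kron (cartan (s\<^sup>2) (t\<^sup>2) a) (cartan (inverse (s\<^sup>2)) (inverse (t\<^sup>2)) a)" (is ?QE)
    and "VV_gen \<iota> s t (QEinv a) = kron (cartan (inverse (s\<^sup>2)) (inverse (t\<^sup>2)) a) (cartan (s\<^sup>2) (t\<^sup>2) a)" (is ?QEinv)
proof -
  have cancel: "inverse s * (t * s) = t" "inverse s * (t * (s * s)) = t * s"
    using assms(3) by (simp_all add: field_simps)
  show ?E12 ?E21 ?E23 ?E32 ?SigmaG ?QE ?QEinv
  using assms(3,4)
  by (simp_all add: cancel VV_gen_eval field_embedding_simps[OF assms(1)] assms(2) power2_eq_square mult.assoc)
qed

lemma uq_rel_sound:
  assumes "uq_rel x y" and emb: "field_embedding \<iota>" "\<iota> qv = s\<^sup>2" and nz: "s \<noteq> 0" "t \<noteq> 0"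
    and s4: "s\<^sup>2 \<noteq> inverse (s\<^sup>2)"
  shows "expr_action \<iota> (VV_gen \<iota> s t) x = expr_action \<iota> (VV_gen \<iota> s t) y"
  unfolding matrix_eq vec_eq_iff
proof -
  note simps = forall_4 expr_defs VV_gen_values[OF emb nz] kron_plus kron_munit_diag4 kron_diag4_munit
      kron_diag4_diag4 matrix_vector_mul_assoc[symmetric] matrix_vector_mult_add_rdistrib mat_vec_nth
      field_embedding_simps[OF emb(1)] emb(2) cartan_def
  have qs: "(s\<^sup>2 - inverse (s\<^sup>2)) \<noteq> 0" using s4 by simp
  define s' t' r where "s' = inverse s" and "t' = inverse t" and "r = inverse (s\<^sup>2 - s'\<^sup>2)"
  then have inv: "inverse s = s'" "inverse t = t'" "inverse (s\<^sup>2) = s'\<^sup>2" "inverse (t\<^sup>2) = t'\<^sup>2"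
      "inverse s' = s" "inverse t' = t" "inverse (s\<^sup>2 - s'\<^sup>2) = r"
    by (simp_all add: power_inverse)
  have c: "s * s' = 1" "t * t' = 1" "r * (s\<^sup>2 - s'\<^sup>2) = 1"
    using nz s4 by (simp_all add: s'_def t'_def r_def power_inverse)
  have r: "r * (s * s) = 1 + r * (s' * s')"
    using c(3) by (simp add: power2_eq_square right_diff_distrib diff_eq_eq)
  have cancel: "s * s' = 1" "s * (s' * x) = x" "t * t' = 1" "t * (t' * x) = x"
    "r * (s * s) = 1 + r * (s' * s')" "r * (s * (s * x)) = x + r * (s' * (s' * x))" for x
  proof -
    show "s * (s' * x) = x" "t * (t' * x) = x"
      by (simp_all only: mult.assoc[symmetric] c mult_1)
    show "r * (s * (s * x)) = x + r * (s' * (s' * x))"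
      using arg_cong[OF r, of "\<lambda>z. z * x"] by (simp only: mult.assoc distrib_right mult_1)
  qed (rule c r)+
  have cancel': "r * (s' * (s' * (s' * (s' * x)))) = r * x - s' * (s' * x)" for x
    using cancel(6)[of "s' * (s' * x)"] by (simp add: cancel(2))
  have *: "\<forall>w. \<forall>i j. (expr_action \<iota> (VV_gen \<iota> s t) x *v w) $ (i, j)
      = (expr_action \<iota> (VV_gen \<iota> s t) y *v w) $ (i, j)" 
    using assms(1)
  proof (cases rule: uq_rel.cases)
    case (1 a)
    then show ?thesis using exhaust_3[of a] nz by (auto simp: simps field_simps)
  next
    case (2 a)
    then show ?thesis using exhaust_3[of a] nz by (auto simp: simps field_simps)
  next
    case (3 a b)
    then show ?thesis using exhaust_3[of a] exhaust_3[of b] by (auto simp: simps)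
  next
    case (4 z a)
    then show ?thesis using exhaust_3[of a] unfolding 4 by (elim insertE emptyE disjE; simp add: simps inv power_int_minus; simp add: cancel inv algebra_simps power2_eq_square power4_eq_xxxx)
  next
    case 5 then show ?thesis by (simp add: simps)
  next
    case 6 then show ?thesis by (simp add: simps)
  next
    case 7 then show ?thesis using nz by (simp add: simps)
  next
    case 8 then show ?thesis using nz by (simp add: simps)
  next
    case 9 then show ?thesis unfolding 9 by (simp add: simps qbracket_def qnumber_def divide_inverse inv) (simp add: cancel cancel' inv algebra_simps power2_eq_square power4_eq_xxxx)
  next
    case 10 then show ?thesis unfolding 10 by (simp add: simps qbracket_def qnumber_def divide_inverse inv) (simp add: cancel inv algebra_simps power2_eq_square power4_eq_xxxx)
  next
    case 11 then show ?thesis unfolding 11 E13_expr_def by (simp add: simps inv) (simp add: cancel inv algebra_simps power2_eq_square power4_eq_xxxx)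
  next
    case 12 then show ?thesis unfolding 12 E31_expr_def by (simp add: simps inv) (simp add: cancel inv algebra_simps power2_eq_square power4_eq_xxxx)
  next
    case 13 then show ?thesis by (simp add: simps)
  next
    case (14 z a)
    then show ?thesis using exhaust_3[of a] by (auto simp: simps)
  next
    case (15 z)
    then show ?thesis by (auto simp: simps)
  qed
  then show "\<forall>w. \<forall>p. (expr_action \<iota> (VV_gen \<iota> s t) x *v w) $ p
      = (expr_action \<iota> (VV_gen \<iota> s t) y *v w) $ p" 
    by (simp add: split_paired_All)
qed


lemma mat_plus: "mat (a + b) = mat a + (mat b :: 'a::semiring_1^'n^'n)"
  by (simp add: mat_def vec_eq_iff)

lemma mat_times: "mat (a * b) = mat a ** (mat b :: 'a::field^'n^'n)"
  unfolding matrix_eq vec_eq_iff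
  by (simp add: matrix_vector_mul_assoc[symmetric] mat_vec_nth mult.assoc)

lemma matrix_plus_mult: "(A + B) ** C = A ** C + B ** (C :: 'a::semiring_1^'n^'m)"
  by (simp add: matrix_matrix_mult_def vec_eq_iff sum.distrib distrib_right)

lemma mat_uminus_cancel: "mat (- 1) ** A + A = 0" for A :: "'a::field^'n^'n"
proof -
  have "mat (- 1) ** A + mat 1 ** A = mat 0 ** A"
    by (simp only: matrix_plus_mult[symmetric] mat_plus[symmetric]) simp
  moreover have "mat 0 ** A = 0"
    by (simp add: mat_def matrix_matrix_mult_def vec_eq_iff)
  ultimately show ?thesis by (simp add: matrix_mul_lid)
qed

lemma mat_central: "mat a ** A = A ** mat a" for A :: "'a::field^'n^'n"
proof -
  have "(mat a :: 'a^'n^'n) *v w = a *s w" for w :: "'a^'n"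
    by (simp add: vec_eq_iff mat_vec_nth)
  then show ?thesis
    unfolding matrix_eq by (simp add: matrix_vector_mul_assoc[symmetric] vec.scale)
qed

lemma embedding_q4: 
  assumes "field_embedding \<iota>" "s\<^sup>2 = \<iota> qv"
  shows "s \<noteq> 0" "s\<^sup>2 \<noteq> inverse (s\<^sup>2)"
proof -
  note e = field_embedding_simps[OF assms(1)]
  show "s \<noteq> 0" using assms(2) qv_square(2) e(8)[of qv] by auto
  have "\<iota> (qv * qv - 1) \<noteq> 0"
    unfolding e(8) using qv_square(1) by simp
  then have "\<iota> qv * \<iota> qv \<noteq> 1" by (simp add: e)
  then show "s\<^sup>2 \<noteq> inverse (s\<^sup>2)"
    unfolding assms(2) using \<open>s \<noteq> 0\<close> assms(2)
    by (metis right_inverse zero_eq_power2)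
qed

lemma uq_eq_sound:
  assumes "uq_eq x y" and emb: "field_embedding \<iota>" "s\<^sup>2 = \<iota> qv" and nz: "t \<noteq> 0"
  shows "expr_action \<iota> (VV_gen \<iota> s t) x = expr_action \<iota> (VV_gen \<iota> s t) y"
  using assms(1)
proof induction
  case (uq_rel x y)
  then show ?case using uq_rel_sound emb nz embedding_q4[OF emb] by metis
next
  case (uq_scal_central a x)
  then show ?case by (simp add: expr_defs mat_central)
next
  case (uq_plus_minus x)
  then show ?case
    by (simp add: expr_defs field_embedding_simps[OF emb(1)] mat_uminus_cancel)
qed (simp_all add: expr_defs field_embedding_simps[OF emb(1)] mat_plus mat_times
  matrix_add_ldistrib matrix_plus_mult matrix_mul_assoc[symmetric] ac_simps
  matrix_mul_lid matrix_mul_rid)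

lemma VV_action_abs:
  assumes "field_embedding \<iota>" "s\<^sup>2 = \<iota> qv" "t \<noteq> 0"
  shows "VV_action \<iota> s t (abs_U x) = expr_action \<iota> (VV_gen \<iota> s t) x"
  unfolding VV_action_def
  by (rule uq_eq_sound[OF _ assms]) (metis Quotient3_U Quotient3_def U.abs_eq_iff uq_refl)

lemma VV_action_hom:
  assumes "field_embedding \<iota>" "s\<^sup>2 = \<iota> qv" "t \<noteq> 0"
  shows "VV_action \<iota> s t (Ugen g) = VV_gen \<iota> s t g"
    and "VV_action \<iota> s t (Uscal c) = mat (\<iota> c)"
    and "VV_action \<iota> s t (X + Y) = VV_action \<iota> s t X + VV_action \<iota> s t Y"
    and "VV_action \<iota> s t (X * Y) = VV_action \<iota> s t X ** VV_action \<iota> s t Y"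
    and "VV_action \<iota> s t 1 = mat 1"
proof -
  note abs = VV_action_abs[OF assms]
  obtain x y where xy: "X = abs_U x" "Y = abs_U y"
    by (metis Quotient3_U Quotient3_abs_rep)
  show "VV_action \<iota> s t (Ugen g) = VV_gen \<iota> s t g" "VV_action \<iota> s t (Uscal c) = mat (\<iota> c)"
    by (simp_all add: Ugen_def Uscal_def abs)
  show "VV_action \<iota> s t (X + Y) = VV_action \<iota> s t X + VV_action \<iota> s t Y"
    "VV_action \<iota> s t (X * Y) = VV_action \<iota> s t X ** VV_action \<iota> s t Y"
    by (simp_all add: xy plus_U.abs_eq times_U.abs_eq abs) (simp_all add: expr_defs)
  show "VV_action \<iota> s t 1 = mat 1"
    by (simp add: one_U_def abs expr_defs field_embedding_simps[OF assms(1)])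
qed

definition B_monomials :: "U list" where
  "B_monomials =
    [1, uE23, uE13, uE31, uE32,
     uE23 * uE13, uE23 * uE31, uE23 * uE32, uE13 * uE31, uE13 * uE32, uE31 * uE32,
     uE13 * uE31 * uE32, uE23 * uE31 * uE32, uE23 * uE13 * uE32, uE23 * uE13 * uE31,
     uE23 * uE13 * uE31 * uE32]"

definition B_basis :: "(Cq \<Rightarrow> 'k::field) \<Rightarrow> 'k \<Rightarrow> 'k \<Rightarrow> ('k^(4 \<times> 4)) list" where
  "B_basis \<iota> s t = map (\<lambda>X. VV_action \<iota> s t X *v axis (1, 1) 1) B_monomials"

text \<open>The condition \<open>\<alpha> \<noteq> 0, -1\<close>, read as \<open>[\<alpha>]\<^sub>q \<noteq> 0\<close> and \<open>[\<alpha>+1]\<^sub>q \<noteq> 0\<close> (that is, \<open>q\<^bsup>2\<alpha>\<^esup>\<close> and \<open>q\<^bsup>2\<alpha>+2\<^esup>\<close> differ from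
  \<open>1\<close>). It holds automatically when \<open>t\<close> is transcendental over \<open>range \<iota>\<close>.\<close>

definition alpha_admissible :: "'k::field \<Rightarrow> 'k \<Rightarrow> bool" where
  "alpha_admissible s t \<longleftrightarrow>
    t \<noteq> 0 \<and> qnumber (s\<^sup>2) (t\<^sup>2) \<noteq> 0 \<and> qnumber (s\<^sup>2) (t\<^sup>2 * s\<^sup>2) \<noteq> 0"

definition is_ordered_basis :: "('k::field^'n) list \<Rightarrow> bool" where
  "is_ordered_basis bs \<longleftrightarrow>
    distinct bs \<and> vec.independent (set bs) \<and> vec.span (set bs) = UNIV"

definition coeff_in_basis :: "('k::field^'n) list \<Rightarrow> 'k^'n^'n \<Rightarrow> nat \<Rightarrow> nat \<Rightarrow> 'k" where
  "coeff_in_basis bs A i j = vec.representation (set bs) (A *v (bs ! j)) (bs ! i)"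

end

theory Submission
  imports Defs
begin

text \<open>
  Why the matrices are free of \<open>q\<^sup>\<alpha>\<close>: the vector \<open>v = e\<^sub>1 \<otimes> e\<^sub>1\<^sup>*\<close> spans a one-dimensional module of the
  even subalgebra generated by \<open>\<sigma>\<close>, the \<open>q\<close> to the power \<open>\<plusminus>E\<^sup>a\<^sub>a\<close>, \<open>E\<^sup>1\<^sub>2\<close> and \<open>E\<^sup>2\<^sub>1\<close>, on which these
  act by \<open>1\<close>, \<open>1\<close>, \<open>0\<close> and \<open>0\<close>. No \<open>\<alpha>\<close> occurs there, so the module induced from it to \<open>U\<close> is
  defined over \<open>\<complex>(q)\<close> and independent of \<open>\<alpha>\<close>. By a Poincare-Birkhoff-Witt argument it is spanned
  by the 16 ordered monomials in the odd elements \<open>E\<^sup>2\<^sub>3, E\<^sup>1\<^sub>3, E\<^sup>3\<^sub>1, E\<^sup>3\<^sub>2\<close>, all of which square to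
  zero. The tensor product \<open>V\<^sub>\<alpha> \<otimes> V\<^sub>\<alpha>\<^sup>*\<close> has dimension 16 and is a quotient of this induced module as
  soon as \<open>v\<close> generates it; then the 16 vectors form a basis and the matrices are those of the
  induced module.

  Only spanning has to be shown in \<open>U\<close>. Attaching the four odd elements one after the other, from
  right to left, to a left module of the even subalgebra gives four nested spaces, and the
  commutation relations between a generator and the element just attached show that the last space
  is stable under all of \<open>U\<close> (\<open>U_stable\<close>).
  Applied to the elements that map \<open>v\<close> to a \<open>\<complex>(q)\<close>-multiple of itself, with the same factor for
  every \<open>\<alpha>\<close>, this expands every \<open>X v\<close> in the 16 vectors with coefficients in \<open>\<complex>(q)\<close> chosen before
  \<open>\<alpha>\<close> (\<open>expandable_UNIV\<close>).

  Cyclicity (\<open>span_B_basis\<close>) is where \<open>[\<alpha>]\<^sub>q \<noteq> 0\<close> and \<open>[\<alpha>+1]\<^sub>q \<noteq> 0\<close> enter: the generators \<open>E\<^sup>3\<^sub>2, E\<^sup>2\<^sub>1\<close>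
  kill \<open>e\<^sub>1\<^sup>*\<close> and lead from \<open>e\<^sub>1\<close> through \<open>e\<^sub>2\<close> and \<open>e\<^sub>3\<close> to \<open>e\<^sub>4\<close>, with those two numbers as factors.
  Afterwards \<open>E\<^sup>2\<^sub>3\<close> and \<open>E\<^sup>1\<^sub>2\<close> lead from \<open>e\<^sub>1\<^sup>*\<close> to the other \<open>e\<^sub>j\<^sup>*\<close>, modulo vectors already reached.
\<close>

section \<open>Commutation relations\<close>

lemma Uscal_plus: "Uscal (x + y) = Uscal x + Uscal y"
  by transfer (rule uq_scal_plus)

lemma Uscal_times: "Uscal (x * y) = Uscal x * Uscal y"
  by transfer (rule uq_scal_times)

lemma Uscal_central: "X * Uscal c = Uscal c * X"
  by transfer (rule uq_sym[OF uq_scal_central])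

lemma Uscal_0: "Uscal 0 = 0"
  by transfer (simp add: zero_expr_def uq_refl)

lemma Uscal_1: "Uscal 1 = 1"
  by transfer (simp add: one_expr_def uq_refl)

lemma Uscal_uminus: "Uscal (- c) = - Uscal c"
  using Uscal_plus[of "- c" c] by (simp add: Uscal_0 eq_neg_iff_add_eq_0)

lemma Uscal_minus: "Uscal (x - y) = Uscal x - Uscal y"
  using Uscal_plus[of x "- y"] by (simp add: Uscal_uminus)

lemma Uscal_left_commute: "X * (Uscal c * Y) = Uscal c * (X * Y)"
  by (metis Uscal_central mult.assoc)

lemma Uscal_Uscal: "Uscal x * (Uscal y * X) = Uscal (x * y) * X"
  by (simp add: Uscal_times mult.assoc)

lemma Uscal_cancel:
  assumes "c \<noteq> 0" "Uscal c * X = 0"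
  shows "X = 0"
proof -
  have "X = Uscal (inverse c) * (Uscal c * X)"
    using assms(1) by (simp add: Uscal_Uscal Uscal_1)
  then show ?thesis by (simp add: assms(2))
qed

abbreviation "uK \<equiv> \<lambda>i. Ugen (QE i)"
abbreviation "uKinv \<equiv> \<lambda>i. Ugen (QEinv i)"

lemma abs_U_minus: "abs_U (x - y) = abs_U x - abs_U y"
proof -
  have "x - y = x + (- y)" by (simp add: expr_defs)
  then show ?thesis by (simp add: minus_U_def plus_U.abs_eq uminus_U.abs_eq)
qed

lemmas abs_U_fold = Ugen.abs_eq[symmetric] Uscal.abs_eq[symmetric] plus_U.abs_eq[symmetric]
  times_U.abs_eq[symmetric] one_U.abs_eq[symmetric] zero_U.abs_eq[symmetric]
  uminus_U.abs_eq[symmetric] abs_U_minus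

lemma uq_rel_abs_U: "uq_rel x y \<Longrightarrow> abs_U x = abs_U y"
  by (simp add: U.abs_eq_iff uq_eq.uq_rel)

lemmas uq_rel_in_U = uq_rel.intros[THEN uq_rel_abs_U,
  unfolded qbracket_def E13_expr_def E31_expr_def abs_U_fold, folded uE13_def uE31_def]

lemma
  shows Kinv_K: "uKinv i * uK i = 1"
    and K_conjugation: "x \<in> {E12, E21, E23, E32} \<Longrightarrow>
      uK i * Ugen x * uKinv i = Uscal (qv powi weight x i) * Ugen x"
    and E32_E32: "uE32 * uE32 = 0"
    and E23_E23: "uE23 * uE23 = 0"
    and E12_E32: "uE12 * uE32 = uE32 * uE12"
    and E21_E23: "uE21 * uE23 = uE23 * uE21"
    and E12_E21: "uE12 * uE21 =
      Uscal (inverse (qv - inverse qv)) * (uK 1 * uKinv 2 - uKinv 1 * uK 2) + uE21 * uE12"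
    and E23_E32: "uE23 * uE32 =
      Uscal (inverse (qv - inverse qv)) * (uK 2 * uK 3 - uKinv 2 * uKinv 3) - uE32 * uE23"
    and E12_E13: "uE12 * uE13 = Uscal qv * (uE13 * uE12)"
    and E31_E21: "uE31 * uE21 = Uscal (inverse qv) * (uE21 * uE31)"
    and sigma_even: "x \<in> {QE i, QEinv i, E12, E21} \<Longrightarrow> Ugen SigmaG * Ugen x = Ugen x * Ugen SigmaG"
    and sigma_odd: "x \<in> {E23, E32} \<Longrightarrow> Ugen SigmaG * Ugen x = - (Ugen x * Ugen SigmaG)"
  by (fact uq_rel_in_U)+

lemma Ugen_K_commute:
  assumes "x \<in> {E12, E21, E23, E32}"
  shows "uK i * Ugen x = Uscal (qv powi weight x i) * (Ugen x * uK i)"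
    and "uKinv i * Ugen x = Uscal (qv powi (- weight x i)) * (Ugen x * uKinv i)"
proof -
  note rel = K_conjugation[OF assms, of i]
  have "uK i * Ugen x = uK i * Ugen x * uKinv i * uK i"
    by (simp add: mult.assoc Kinv_K)
  also have "\<dots> = Uscal (qv powi weight x i) * (Ugen x * uK i)"
    by (subst rel) (simp only: mult.assoc)
  finally show "uK i * Ugen x = Uscal (qv powi weight x i) * (Ugen x * uK i)" .
  have "Ugen x * uKinv i = uKinv i * (uK i * Ugen x * uKinv i)"
    by (simp add: mult.assoc[symmetric] Kinv_K)
  also have "\<dots> = Uscal (qv powi weight x i) * (uKinv i * Ugen x)"
    by (simp only: rel Uscal_left_commute)
  finally show "uKinv i * Ugen x = Uscal (qv powi (- weight x i)) * (Ugen x * uKinv i)"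
    using qv_square(2) by (simp add: Uscal_Uscal Uscal_1 power_int_minus)
qed

text \<open>\<open>q\<close> to the power \<open>\<plusminus>(E\<^sup>1\<^sub>1 - E\<^sup>2\<^sub>2)\<close> and \<open>\<plusminus>(E\<^sup>2\<^sub>2 + E\<^sup>3\<^sub>3)\<close>.\<close>

abbreviation "uh \<equiv> uK 1 * uKinv 2"
abbreviation "uhinv \<equiv> uKinv 1 * uK 2"
abbreviation "ul \<equiv> uK 2 * uK 3"
abbreviation "ulinv \<equiv> uKinv 2 * uKinv 3"

lemma pair_commute:
  "uh * uE23 = Uscal (inverse qv) * (uE23 * uh)"  "uhinv * uE23 = Uscal qv * (uE23 * uhinv)"
  "uh * uE32 = Uscal qv * (uE32 * uh)"  "uhinv * uE32 = Uscal (inverse qv) * (uE32 * uhinv)"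
  "ul * uE12 = Uscal (inverse qv) * (uE12 * ul)"  "ulinv * uE12 = Uscal qv * (uE12 * ulinv)"
  by (simp_all add: Ugen_K_commute mult.assoc Uscal_left_commute power_int_minus Uscal_1)
    (simp_all add: Ugen_K_commute mult.assoc[symmetric] power_int_minus Uscal_1)

lemmas pair_commute_assoc = pair_commute[unfolded mult.assoc]

lemma diff_inverse_qv: "inverse (qv - inverse qv) * (1 - qv * qv) = - qv"
    "inverse (qv - inverse qv) * (qv - inverse qv) = 1"
proof -
  have "qv - inverse qv \<noteq> 0" using qv_square by (simp add: field_simps)
  then show "inverse (qv - inverse qv) * (1 - qv * qv) = - qv"
    "inverse (qv - inverse qv) * (qv - inverse qv) = 1"
    using qv_square by (auto simp: field_simps)
qed

text \<open>The general law \<open>Uscal_left_commute\<close> loops as a rewrite rule, since its left factor may itself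
  be a scalar; restricted to generators and root vectors it moves every scalar to the front.\<close>

lemma Uscal_past_generators:
  "Ugen g * (Uscal c * X) = Uscal c * (Ugen g * X)"
  "uE13 * (Uscal c * X) = Uscal c * (uE13 * X)"
  "uE31 * (Uscal c * X) = Uscal c * (uE31 * X)"
  by (rule Uscal_left_commute)+

lemmas U_expand = mult.assoc distrib_left distrib_right left_diff_distrib right_diff_distrib
  Uscal_past_generators Uscal_Uscal

lemma Uscal_combine: "Uscal x * X - Uscal y * X = Uscal (x - y) * X"
  "Uscal x * X + Uscal y * X = Uscal (x + y) * X"
  by (simp_all add: Uscal_minus Uscal_plus distrib_right left_diff_distrib)

text \<open>Here, and likewise in \<open>E21_E13\<close> and \<open>E32_E13\<close>, the left factor and one of the two generators in
  the root vector have a quantum bracket as their commutator or anticommutator. It appears once on either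
  side of the other generator. These two brackets are combined by moving one of them past a generator of nonzero weight:
  one of the two exponentials cancels and the other survives.\<close>

lemma E12_E31: "uE12 * uE31 = uE31 * uE12 - Uscal qv * (uE32 * uh)"
proof -
  define r where "r = inverse (qv - inverse qv)"
  note ef = E12_E21[folded r_def]
  have "uE12 * uE31 = (uE12 * uE32) * uE21 - Uscal qv * ((uE12 * uE21) * uE32)"
    by (simp only: uE31_def U_expand)
  also have "\<dots> = uE32 * (uE12 * uE21) - Uscal qv * ((uE12 * uE21) * uE32)"
    by (simp only: E12_E32 mult.assoc)
  also have "\<dots> = uE32 * (Uscal r * (uh - uhinv)) + uE32 * uE21 * uE12
     - Uscal qv * (Uscal r * (uh * uE32 - uhinv * uE32)) - Uscal qv * (uE21 * uE32 * uE12)"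
    by (simp add: ef distrib_left distrib_right mult.assoc left_diff_distrib E12_E32)
  also have "\<dots> = uE31 * uE12 + (Uscal r * (uE32 * uh) - Uscal (r * (qv * qv)) * (uE32 * uh)) +
     (Uscal (r * (qv * inverse qv)) * (uE32 * uhinv) - Uscal r * (uE32 * uhinv))"
    by (simp add: pair_commute_assoc uE31_def U_expand mult_ac)
  also have "\<dots> = uE31 * uE12 - Uscal qv * (uE32 * uh)"
    using diff_inverse_qv(1) qv_square(2)
    by (simp add: Uscal_combine r_def algebra_simps Uscal_uminus Uscal_0)
  finally show ?thesis .
qed

lemma E21_E13: "uE21 * uE13 = uE13 * uE21 + uE23 * uhinv"
proof -
  define r where "r = inverse (qv - inverse qv)"
  have fe: "uE21 * uE12 = uE12 * uE21 - Uscal r * (uh - uhinv)"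
    using E12_E21 by (simp add: r_def)
  have "uE21 * uE13 = (uE21 * uE12) * uE23 - Uscal (inverse qv) * ((uE21 * uE23) * uE12)"
    by (simp only: uE13_def U_expand)
  also have "\<dots> = (uE21 * uE12) * uE23 - Uscal (inverse qv) * (uE23 * (uE21 * uE12))"
    by (simp only: E21_E23 mult.assoc)
  also have "\<dots> = uE12 * (uE21 * uE23) - Uscal (inverse qv) * (uE23 * uE12 * uE21)
     - Uscal r * (uh * uE23 - uhinv * uE23)
     + Uscal (inverse qv) * (uE23 * (Uscal r * (uh - uhinv)))"
    by (simp add: fe U_expand)
  also have "\<dots> = uE13 * uE21 + (Uscal (r * inverse qv) * (uE23 * uh) - Uscal (r * inverse qv) * (uE23 * uh)) +
     (Uscal (r * qv) * (uE23 * uhinv) - Uscal (r * inverse qv) * (uE23 * uhinv))"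
    by (simp add: pair_commute_assoc uE13_def E21_E23 U_expand mult_ac)
  also have "\<dots> = uE13 * uE21 + uE23 * uhinv"
    using diff_inverse_qv(2)
    by (simp add: Uscal_combine r_def right_diff_distrib[symmetric] Uscal_1)
  finally show ?thesis .
qed

lemma E32_E23:
  "uE32 * uE23 = Uscal (inverse (qv - inverse qv)) * (ul - ulinv) - uE23 * uE32"
  using E23_E32 by simp

lemma E32_E13: "uE32 * uE13 = Uscal (inverse qv) * (uE12 * ul) - uE13 * uE32"
proof -
  define r where "r = inverse (qv - inverse qv)"
  note da = E32_E23[folded r_def]
  have "uE32 * uE13 = (uE32 * uE12) * uE23 - Uscal (inverse qv) * ((uE32 * uE23) * uE12)"
    by (simp only: uE13_def U_expand)
  also have "\<dots> = uE12 * (uE32 * uE23) - Uscal (inverse qv) * ((uE32 * uE23) * uE12)"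
    by (simp only: E12_E32[symmetric] mult.assoc)
  also have "\<dots> = uE12 * (Uscal r * (ul - ulinv)) - Uscal (inverse qv) * (Uscal r * (ul * uE12 - ulinv * uE12))
      - uE12 * uE23 * uE32 + Uscal (inverse qv) * (uE23 * (uE12 * uE32))"
    by (simp add: da U_expand E12_E32)
  also have "\<dots> = (Uscal r * (uE12 * ul) - Uscal (inverse qv * r * inverse qv) * (uE12 * ul))
     + (Uscal (inverse qv * r * qv) * (uE12 * ulinv) - Uscal r * (uE12 * ulinv)) - uE13 * uE32"
    by (simp add: pair_commute_assoc uE13_def U_expand)
  also have "\<dots> = Uscal (inverse qv) * (uE12 * ul) - uE13 * uE32"
  proof -
    have "r - inverse qv * r * inverse qv = inverse qv * (r * (qv - inverse qv))"
      using qv_square(2) by (simp add: algebra_simps)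
    also have "\<dots> = inverse qv"
      using diff_inverse_qv(2) by (simp add: r_def)
    finally have 1: "r - inverse qv * r * inverse qv = inverse qv" .
    have 2: "inverse qv * r * qv = r"
      using qv_square(2) by simp
    show ?thesis
      by (simp only: Uscal_combine 1 2) (simp add: Uscal_0)
  qed
  finally show ?thesis .
qed

lemma E32_E31: "uE32 * uE31 = - (Uscal qv * (uE31 * uE32))"
proof -
  have dd: "uE32 * (uE32 * X) = 0" for X
    by (simp add: mult.assoc[symmetric] E32_E32)
  show ?thesis
    by (simp add: uE31_def U_expand dd E32_E32)
qed

lemma E23_E13: "uE23 * uE13 = - (Uscal qv * (uE13 * uE23))"
proof -
  have aa: "uE23 * (uE23 * X) = 0" for X
    by (simp add: mult.assoc[symmetric] E23_E23)
  show ?thesis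
    using qv_square(2) by (simp add: uE13_def U_expand aa E23_E23 Uscal_Uscal Uscal_1)
qed

lemma one_plus_qv_square: "1 + qv * qv \<noteq> 0"
  by (simp add: qv_def One_fract_def eq_fract one_pCons Zero_fract_def)

text \<open>Expanding one or the other of the two factors gives \<open>D\<close> and \<open>- q\<^sup>-\<^sup>2 D\<close> for the square, where \<open>D\<close> is
  the commutator of \<open>E\<^sup>1\<^sub>2\<close> and \<open>E\<^sup>2\<^sub>3 E\<^sup>1\<^sub>3\<close>. As \<open>1 + q\<^sup>2 \<noteq> 0\<close>, the square vanishes.\<close>

lemma E13_E13: "uE13 * uE13 = 0"
proof -
  define D where "D = uE12 * uE23 * uE13 - uE23 * uE13 * uE12"
  have "uE13 * uE13 = uE12 * uE23 * uE13 - Uscal (inverse qv) * (uE23 * (uE12 * uE13))"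
    by (subst (1) uE13_def) (simp add: U_expand)
  also have "\<dots> = D"
    using qv_square(2) by (simp add: E12_E13 D_def U_expand Uscal_1)
  finally have 1: "uE13 * uE13 = D" .
  have be: "uE13 * (uE12 * X) = Uscal (inverse qv) * (uE12 * (uE13 * X))" for X
  proof -
    have "uE13 * uE12 = Uscal (inverse qv) * (uE12 * uE13)"
      using qv_square(2) by (simp add: E12_E13 Uscal_Uscal Uscal_1)
    then show ?thesis by (simp add: mult.assoc[symmetric])
  qed
  have "uE13 * uE13 = uE13 * uE12 * uE23 - Uscal (inverse qv) * (uE13 * uE23 * uE12)"
    by (subst (2) uE13_def) (simp add: U_expand)
  also have "Uscal (qv * qv) * \<dots> = - D"
    using qv_square(2)
    by (simp add: D_def U_expand E23_E13 be)
  finally have "Uscal (qv * qv) * (uE13 * uE13) = - D" .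
  then have "Uscal (1 + qv * qv) * (uE13 * uE13) = 0"
    by (simp add: Uscal_plus Uscal_1 distrib_right 1)
  then show ?thesis by (rule Uscal_cancel[OF one_plus_qv_square])
qed

lemma E21_E31: "uE21 * uE31 = Uscal qv * (uE31 * uE21)"
  using qv_square(2) by (simp add: E31_E21 Uscal_Uscal Uscal_1)

text \<open>The same argument, now with the values \<open>D\<close> and \<open>- q\<^sup>2 D\<close>.\<close>

lemma E31_E31: "uE31 * uE31 = 0"
proof -
  define D where "D = uE31 * uE32 * uE21 - uE21 * uE31 * uE32"
  have "uE31 * uE31 = uE31 * uE32 * uE21 - Uscal qv * (uE31 * uE21 * uE32)"
    by (subst (2) uE31_def) (simp add: U_expand)
  also have "\<dots> = D"
    using qv_square(2) by (simp add: E31_E21 D_def U_expand Uscal_1)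
  finally have 1: "uE31 * uE31 = D" .
  have "uE31 * uE31 = uE32 * (uE21 * uE31) - Uscal qv * (uE21 * (uE32 * uE31))"
    by (subst (1) uE31_def) (simp add: U_expand)
  also have "\<dots> = Uscal qv * (uE32 * uE31 * uE21) - Uscal qv * (uE21 * (uE32 * uE31))"
    by (simp add: E21_E31 U_expand)
  also have "\<dots> = - (Uscal (qv * qv) * D)"
    by (simp add: D_def U_expand E32_E31)
  finally have "uE31 * uE31 = - (Uscal (qv * qv) * D)" .
  then have "Uscal (1 + qv * qv) * (uE31 * uE31) = 0"
    by (simp add: Uscal_plus Uscal_1 distrib_right eq_neg_iff_add_eq_0 flip: 1)
  then show ?thesis by (rule Uscal_cancel[OF one_plus_qv_square])
qed

lemma E12_E23: "uE12 * uE23 = uE13 + Uscal (inverse qv) * (uE23 * uE12)"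
  by (simp add: uE13_def)

lemma E21_E32: "uE21 * uE32 = Uscal (inverse qv) * (uE32 * uE21 - uE31)"
  using qv_square(2) by (simp add: uE31_def Uscal_Uscal Uscal_1)

section \<open>Attaching odd elements to a module of the even subalgebra\<close>

definition scalar_subspace :: "U set \<Rightarrow> bool" where
  "scalar_subspace R \<longleftrightarrow> 0 \<in> R \<and> (\<forall>X\<in>R. \<forall>Y\<in>R. X + Y \<in> R) \<and> (\<forall>c. \<forall>X\<in>R. Uscal c * X \<in> R)"

definition extend :: "U \<Rightarrow> U set \<Rightarrow> U set" where
  "extend x R = {X + x * Y | X Y. X \<in> R \<and> Y \<in> R}"

text \<open>The separate target is needed for generators that move one of the nested spaces below into a
  later one. As a property of the operator \<open>g\<close>, stability can be read off from the two sides of a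
  commutation relation by rules for sums and products.\<close>

definition carries :: "U \<Rightarrow> U set \<Rightarrow> U set \<Rightarrow> bool" where
  "carries g R R' \<longleftrightarrow> (\<forall>X\<in>R. g * X \<in> R')"

lemma scalar_subspaceD:
  assumes "scalar_subspace R"
  shows "0 \<in> R" "X \<in> R \<Longrightarrow> Y \<in> R \<Longrightarrow> X + Y \<in> R" "X \<in> R \<Longrightarrow> Uscal c * X \<in> R"
    "X \<in> R \<Longrightarrow> Y \<in> R \<Longrightarrow> X - Y \<in> R" "X \<in> R \<Longrightarrow> - X \<in> R"
proof -
  show *: "0 \<in> R" "X \<in> R \<Longrightarrow> Y \<in> R \<Longrightarrow> X + Y \<in> R" "X \<in> R \<Longrightarrow> Uscal c * X \<in> R" for X Y c
    using assms by (auto simp: scalar_subspace_def)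
  show neg: "X \<in> R \<Longrightarrow> - X \<in> R" for X
    using *(3)[of X "- 1"] by (simp add: Uscal_uminus Uscal_1)
  show "X \<in> R \<Longrightarrow> Y \<in> R \<Longrightarrow> X - Y \<in> R"
    using *(2)[of X "- Y"] neg by simp
qed

lemma scalar_subspace_extend:
  assumes "scalar_subspace R"
  shows "scalar_subspace (extend x R)"
  unfolding scalar_subspace_def
proof (intro conjI ballI allI)
  note R = scalar_subspaceD[OF assms]
  have "0 + x * 0 \<in> extend x R"
    unfolding extend_def using R(1) by blast
  then show "0 \<in> extend x R" by simp
  show "X + Y \<in> extend x R" if XY: "X \<in> extend x R" "Y \<in> extend x R" for X Y
  proof -
    obtain X1 X2 Y1 Y2 where eq: "X = X1 + x * X2" "Y = Y1 + x * Y2"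
      and "X1 \<in> R" "X2 \<in> R" "Y1 \<in> R" "Y2 \<in> R"
      using XY by (auto simp: extend_def)
    then have "X1 + Y1 \<in> R" "X2 + Y2 \<in> R" using R(2) by auto
    moreover have "X + Y = (X1 + Y1) + x * (X2 + Y2)"
      by (simp add: eq distrib_left ac_simps)
    ultimately show ?thesis unfolding extend_def by blast
  qed
  show "Uscal c * X \<in> extend x R" if X: "X \<in> extend x R" for c X
  proof -
    obtain X1 X2 where eq: "X = X1 + x * X2" and "X1 \<in> R" "X2 \<in> R"
      using X by (auto simp: extend_def)
    then have "Uscal c * X1 \<in> R" "Uscal c * X2 \<in> R" using R(3) by auto
    moreover have "Uscal c * X = Uscal c * X1 + x * (Uscal c * X2)"
      by (simp add: eq distrib_left Uscal_left_commute)
    ultimately show ?thesis unfolding extend_def by blast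
  qed
qed

lemma subset_extend:
  assumes "scalar_subspace R"
  shows "R \<subseteq> extend x R"
proof
  fix X assume "X \<in> R"
  moreover have "X = X + x * 0" by simp
  ultimately show "X \<in> extend x R"
    unfolding extend_def using scalar_subspaceD(1)[OF assms] by blast
qed

lemma carries_into_extend:
  assumes "scalar_subspace R"
  shows "carries x R (extend x R)"
  unfolding carries_def
proof
  fix X assume "X \<in> R"
  moreover have "x * X = 0 + x * X" by simp
  ultimately show "x * X \<in> extend x R"
    unfolding extend_def using scalar_subspaceD(1)[OF assms] by blast
qed

lemma carries_extend:
  assumes "scalar_subspace R'" "carries g R R'" "carries (g * x) R R'"
  shows "carries g (extend x R) R'"
  using assms scalar_subspaceD(2)[OF assms(1)]
  by (auto simp: carries_def extend_def distrib_left mult.assoc)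

lemma carries_combine:
  assumes "scalar_subspace R'"
  shows "carries g R R' \<Longrightarrow> carries h R R' \<Longrightarrow> carries (g + h) R R'"
    "carries g R R' \<Longrightarrow> carries h R R' \<Longrightarrow> carries (g - h) R R'"
    "carries g R R' \<Longrightarrow> carries (- g) R R'"
    "carries g R R' \<Longrightarrow> carries (Uscal c * g) R R'"
    "carries 0 R R'"
  using scalar_subspaceD[OF assms]
  by (auto simp: carries_def distrib_right left_diff_distrib mult.assoc)

lemma carries_times: "carries h R S \<Longrightarrow> carries g S T \<Longrightarrow> carries (g * h) R T"
  by (auto simp: carries_def mult.assoc)

lemma carries_mono: "carries g R S \<Longrightarrow> R' \<subseteq> R \<Longrightarrow> S \<subseteq> S' \<Longrightarrow> carries g R' S'"
  by (auto simp: carries_def)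

lemma carries_self:
  assumes "scalar_subspace R" "x * x = 0"
  shows "carries x (extend x R) (extend x R)"
proof (rule carries_extend)
  show R': "scalar_subspace (extend x R)" by (rule scalar_subspace_extend[OF assms(1)])
  show "carries x R (extend x R)" by (rule carries_into_extend[OF assms(1)])
  show "carries (x * x) R (extend x R)" unfolding assms(2) by (rule carries_combine(5)[OF R'])
qed

lemma carries_commuting:
  assumes "scalar_subspace R" "carries g R R" "g * x = Uscal c * (x * g)"
  shows "carries g (extend x R) (extend x R)"
proof (rule carries_extend)
  show R': "scalar_subspace (extend x R)" by (rule scalar_subspace_extend[OF assms(1)])
  show "carries g R (extend x R)"
    by (rule carries_mono[OF assms(2) order_refl subset_extend[OF assms(1)]])
  show "carries (g * x) R (extend x R)"
    unfolding assms(3)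
    by (rule carries_combine(4)[OF R' carries_times[OF assms(2) carries_into_extend[OF assms(1)]]])
qed

text \<open>The factor is a sign for \<open>\<sigma>\<close> and a power of \<open>q\<close> for the Cartan elements. It is multiplicative,
  and both terms of a root vector are products of the same two generators.\<close>

lemma torus_commute:
  assumes g: "g \<in> {SigmaG, QE i, QEinv i}" and x: "x \<in> {uE23, uE13, uE31, uE32}"
  obtains c where "Ugen g * x = Uscal c * (x * Ugen g)"
proof -
  have "\<exists>c. Ugen g * Ugen y = Uscal c * (Ugen y * Ugen g)" if y: "y \<in> {E12, E21, E23, E32}" for y
  proof (cases "g = SigmaG")
    case True
    consider "y \<in> {E12, E21}" | "y \<in> {E23, E32}" using y by auto
    then show ?thesis
    proof cases
      case 1
      then show ?thesis
        using True sigma_even[of y] by (intro exI[of _ 1]) (auto simp: Uscal_1)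
    next
      case 2
      then show ?thesis
        using True sigma_odd[of y] by (intro exI[of _ "- 1"]) (auto simp: Uscal_1 Uscal_uminus)
    qed
  next
    case False
    then show ?thesis using g Ugen_K_commute[OF y, of i] by auto
  qed
  note gen = this
  have product: "Ugen g * (y * z) = Uscal (c * d) * (y * z * Ugen g)"
    if "Ugen g * y = Uscal c * (y * Ugen g)" "Ugen g * z = Uscal d * (z * Ugen g)" for y z c d
  proof -
    have "Ugen g * (y * z) = Uscal c * (y * (Ugen g * z))"
      by (simp only: that(1) mult.assoc[symmetric])
    then show ?thesis by (simp add: that(2) mult.assoc Uscal_left_commute[of y] Uscal_Uscal)
  qed
  obtain c12 c21 c23 c32 where c:
      "Ugen g * uE12 = Uscal c12 * (uE12 * Ugen g)" "Ugen g * uE21 = Uscal c21 * (uE21 * Ugen g)"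
      "Ugen g * uE23 = Uscal c23 * (uE23 * Ugen g)" "Ugen g * uE32 = Uscal c32 * (uE32 * Ugen g)"
    using gen[of E12] gen[of E21] gen[of E23] gen[of E32] by auto
  have "Ugen g * uE13 = Uscal (c12 * c23) * (uE13 * Ugen g)"
    unfolding uE13_def
    by (simp add: right_diff_distrib left_diff_distrib Uscal_left_commute[of "Ugen g"]
        product[OF c(1,3)] product[OF c(3,1)] Uscal_Uscal mult_ac)
  moreover have "Ugen g * uE31 = Uscal (c32 * c21) * (uE31 * Ugen g)"
    unfolding uE31_def
    by (simp add: right_diff_distrib left_diff_distrib Uscal_left_commute[of "Ugen g"]
        product[OF c(2,4)] product[OF c(4,2)] Uscal_Uscal mult_ac)
  ultimately show thesis using that x c by blast
qed

text \<open>In the application, \<open>R0\<close> consists of the elements that act on \<open>v\<close> by a scalar.\<close>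

locale even_module =
  fixes R0 :: "U set"
  assumes subspace0: "scalar_subspace R0"
    and even0: "g \<in> {SigmaG, QE i, QEinv i, E12, E21} \<Longrightarrow> carries (Ugen g) R0 R0"
begin

text \<open>The order in which the odd elements are attached is that of the factors in the 16 monomials,
  from right to left. \<open>E\<^sup>1\<^sub>2\<close> and the torus preserve every step. \<open>E\<^sup>2\<^sub>1\<close> does not: it turns
  \<open>E\<^sup>3\<^sub>2\<close> into \<open>E\<^sup>3\<^sub>1\<close> and \<open>E\<^sup>1\<^sub>3\<close> into \<open>E\<^sup>2\<^sub>3\<close>, hence moves \<open>R1\<close> into \<open>R2\<close> and \<open>R3\<close> into \<open>R4\<close>.\<close>

definition "R1 = extend uE32 R0"
definition "R2 = extend uE31 R1"
definition "R3 = extend uE13 R2"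
definition "R4 = extend uE23 R3"

lemmas R_defs = R1_def R2_def R3_def R4_def

lemma subspaces: "scalar_subspace R1" "scalar_subspace R2" "scalar_subspace R3" "scalar_subspace R4"
  unfolding R_defs by (intro scalar_subspace_extend subspace0)+

lemma inclusions: "R0 \<subseteq> R1" "R1 \<subseteq> R2" "R2 \<subseteq> R3" "R3 \<subseteq> R4"
  unfolding R_defs by (intro subset_extend scalar_subspace_extend subspace0)+

lemma into_next: "carries uE32 R0 R1" "carries uE31 R1 R2" "carries uE13 R2 R3" "carries uE23 R3 R4"
  unfolding R_defs by (intro carries_into_extend scalar_subspace_extend subspace0)+

lemma odd_self: "carries uE32 R1 R1" "carries uE31 R2 R2" "carries uE13 R3 R3" "carries uE23 R4 R4"
  unfolding R_defs
  by (intro carries_self scalar_subspace_extend subspace0 E32_E32 E23_E23 E13_E13 E31_E31)+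

lemma torus:
  assumes "g \<in> {SigmaG, QE i, QEinv i}"
  shows "carries (Ugen g) R1 R1" "carries (Ugen g) R2 R2" "carries (Ugen g) R3 R3" "carries (Ugen g) R4 R4"
proof -
  have step: "carries (Ugen g) (extend x R) (extend x R)"
    if "scalar_subspace R" "carries (Ugen g) R R" "x \<in> {uE23, uE13, uE31, uE32}" for x R
    using torus_commute[OF assms that(3)] carries_commuting[OF that(1,2)] by metis
  have 0: "carries (Ugen g) R0 R0" using assms by (intro even0) auto
  show 1: "carries (Ugen g) R1 R1" unfolding R1_def by (rule step[OF subspace0 0]) simp
  show 2: "carries (Ugen g) R2 R2" unfolding R2_def by (rule step[OF subspaces(1) 1]) simp
  show 3: "carries (Ugen g) R3 R3" unfolding R3_def by (rule step[OF subspaces(2) 2]) simp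
  show "carries (Ugen g) R4 R4" unfolding R4_def by (rule step[OF subspaces(3) 3]) simp
qed

lemma torus_pairs: "carries uh R1 R1" "carries uhinv R2 R2" "carries ul R2 R2"
  by (rule carries_times[OF torus(1) torus(1)] carries_times[OF torus(2) torus(2)]; simp)+

lemma E12_stable: "carries uE12 R1 R1" "carries uE12 R2 R2" "carries uE12 R3 R3" "carries uE12 R4 R4"
proof -
  have 0: "carries uE12 R0 R0" by (rule even0) simp
  show 1: "carries uE12 R1 R1"
    unfolding R1_def by (rule carries_commuting[OF subspace0 0, where c = 1]) (simp add: E12_E32 Uscal_1)
  show 2: "carries uE12 R2 R2"
    unfolding R2_def
  proof (rule carries_extend, fold R2_def)
    show "carries (uE12 * uE31) R1 R2"
      unfolding E12_E31
      by (intro carries_combine subspaces carries_times[OF 1 into_next(2)]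
          carries_mono[OF carries_times[OF torus_pairs(1) odd_self(1)] order_refl inclusions(2)])
  qed (rule subspaces carries_mono[OF 1 order_refl inclusions(2)])+
  show 3: "carries uE12 R3 R3"
    unfolding R3_def by (rule carries_commuting[OF subspaces(2) 2 E12_E13])
  show "carries uE12 R4 R4"
    unfolding R4_def
  proof (rule carries_extend, fold R4_def)
    show "carries (uE12 * uE23) R3 R4"
      unfolding E12_E23
      by (intro carries_combine subspaces carries_times[OF 3 into_next(4)]
          carries_mono[OF odd_self(3) order_refl inclusions(4)])
  qed (rule subspaces carries_mono[OF 3 order_refl inclusions(4)])+
qed

lemma E21_stable: "carries uE21 R4 R4"
proof -
  have 0: "carries uE21 R0 R0" by (rule even0) simp
  have 1: "carries uE21 R1 R2"
    unfolding R1_def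
  proof (rule carries_extend)
    show "carries (uE21 * uE32) R0 R2"
      unfolding E21_E32
      by (intro carries_combine subspaces carries_mono[OF carries_times[OF 0 into_next(1)] order_refl inclusions(2)]
          carries_mono[OF into_next(2) inclusions(1) order_refl])
  qed (rule subspaces carries_mono[OF 0 order_refl subset_trans[OF inclusions(1,2)]])+
  have 2: "carries uE21 R2 R2"
    unfolding R2_def
  proof (rule carries_extend, fold R2_def)
    show "carries (uE21 * uE31) R1 R2"
      unfolding E21_E31 by (intro carries_combine subspaces carries_times[OF 1 odd_self(2)])
  qed (rule subspaces 1)+
  have 3: "carries uE21 R3 R4"
    unfolding R3_def
  proof (rule carries_extend)
    show "carries (uE21 * uE13) R2 R4"
      unfolding E21_E13
      by (intro carries_combine subspaces carries_mono[OF carries_times[OF 2 into_next(3)] order_refl inclusions(4)]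
          carries_times[OF torus_pairs(2)] carries_mono[OF into_next(4) inclusions(3) order_refl])
  qed (rule subspaces carries_mono[OF 2 order_refl subset_trans[OF inclusions(3,4)]])+
  show ?thesis
    unfolding R4_def
  proof (rule carries_extend, fold R4_def)
    show "carries (uE21 * uE23) R3 R4"
      unfolding E21_E23 by (rule carries_times[OF 3 odd_self(4)])
  qed (rule subspaces 3)+
qed

lemma E32_stable: "carries uE32 R4 R4"
proof -
  have 2: "carries uE32 R2 R2"
    unfolding R2_def
    by (rule carries_commuting[OF subspaces(1) odd_self(1), where c = "- qv"])
      (simp add: E32_E31 Uscal_uminus)
  have 3: "carries uE32 R3 R3"
    unfolding R3_def
  proof (rule carries_extend, fold R3_def)
    show "carries (uE32 * uE13) R2 R3"
      unfolding E32_E13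
      by (intro carries_combine subspaces carries_times[OF 2 into_next(3)]
          carries_mono[OF carries_times[OF torus_pairs(3) E12_stable(2)] order_refl inclusions(3)])
  qed (rule subspaces carries_mono[OF 2 order_refl inclusions(3)])+
  show ?thesis
    unfolding R4_def
  proof (rule carries_extend, fold R4_def)
    have l: "carries ul R3 R4" "carries ulinv R3 R4"
      by (rule carries_mono[OF carries_times[OF torus(3) torus(3)] order_refl inclusions(4)]; simp)+
    show "carries (uE32 * uE23) R3 R4"
      unfolding E32_E23
      by (intro carries_combine subspaces carries_times[OF 3 into_next(4)] l)
  qed (rule subspaces carries_mono[OF 3 order_refl inclusions(4)])+
qed

lemma generator_stable: "carries (Ugen g) R4 R4"
proof (cases g)
  case SigmaG
  then show ?thesis by (intro torus(4)) simp
next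
  case (QE i)
  then show ?thesis by (intro torus(4)[of _ i]) simp
next
  case (QEinv i)
  then show ?thesis by (intro torus(4)[of _ i]) simp
qed (simp_all only: E12_stable(4) E21_stable E32_stable odd_self(4))

lemma U_stable: "carries X R4 R4"
proof (induction X rule: U.abs_induct)
  case (1 x)
  show ?case
  proof (induction x)
    case (Gen g)
    show ?case unfolding Ugen.abs_eq[symmetric] by (rule generator_stable)
  next
    case (Scal c)
    show ?case
      using scalar_subspaceD(3)[OF subspaces(4)] by (simp add: Uscal.abs_eq[symmetric] carries_def)
  next
    case (Plus x y)
    then show ?case
      unfolding plus_expr_def[symmetric] plus_U.abs_eq[symmetric]
      by (rule carries_combine(1)[OF subspaces(4)])
  next
    case (Times x y)
    show ?case
      unfolding times_expr_def[symmetric] times_U.abs_eq[symmetric]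
      by (rule carries_times[OF Times(2,1)])
  qed
qed

end

section \<open>The orbit of \<open>v\<close> for all \<open>\<alpha>\<close> at once\<close>

lemma kron_axis:
  "kron (munit x i j) (diag4 a b c d) *v axis (k, l) 1 =
    (if k = j then (x * pick4 a b c d l) *s axis (i, l) 1 else 0)"
  "kron (diag4 a b c d) (munit x i j) *v axis (k, l) 1 =
    (if l = j then (x * pick4 a b c d k) *s axis (k, i) 1 else 0)"
  "kron (diag4 a b c d) (diag4 a' b' c' d') *v axis (k, l) 1 =
    (pick4 a b c d k * pick4 a' b' c' d' l) *s axis (k, l) 1"
  by (auto simp: vec_eq_iff kron_munit_diag4 kron_diag4_munit kron_diag4_diag4 axis_def)

locale tensor_family =
  fixes \<iota> :: "Cq \<Rightarrow> 'k::field" and s :: 'k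
  assumes embedding: "field_embedding \<iota>" and s_square: "s\<^sup>2 = \<iota> qv"
begin

lemma s_nonzero: "s \<noteq> 0"
  by (rule embedding_q4[OF embedding s_square])

lemmas iota_simps = field_embedding_simps[OF embedding]

text \<open>Here \<open>v\<close> is \<open>axis (1, 1) 1\<close>, for every \<open>\<alpha>\<close>.\<close>

definition act :: "'k \<Rightarrow> U \<Rightarrow> 'k^(4 \<times> 4)" where
  "act t X = VV_action \<iota> s t X *v axis (1, 1) 1"

lemma act_times:
  "t \<noteq> 0 \<Longrightarrow> act t (X * Y) = VV_action \<iota> s t X *v act t Y"
  by (simp add: act_def VV_action_hom[OF embedding s_square] matrix_vector_mul_assoc)

lemma act_simps:
  assumes "t \<noteq> 0"
  shows "act t (X + Y) = act t X + act t Y"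
    and "act t (Uscal c * X) = \<iota> c *s act t X"
    and "act t 0 = 0"
    and "act t 1 = axis (1, 1) 1"
proof -
  note hom = VV_action_hom[OF embedding s_square assms]
  show "act t (X + Y) = act t X + act t Y"
    by (simp add: act_def hom matrix_vector_mult_add_rdistrib)
  show scal: "act t (Uscal c * X) = \<iota> c *s act t X" for c X
    by (simp add: act_times[OF assms] hom) (simp add: vec_eq_iff mat_vec_nth)
  show "act t 0 = 0"
    using scal[of 0 0] by (simp add: iota_simps)
  show "act t 1 = axis (1, 1) 1"
    by (simp add: act_def hom)
qed

lemma act_Ugen: "t \<noteq> 0 \<Longrightarrow> act t (Ugen g * X) = VV_gen \<iota> s t g *v act t X"
  by (simp add: act_times VV_action_hom[OF embedding s_square])

lemmas VV_gen_explicit = VV_gen_values[OF embedding s_square[symmetric] s_nonzero]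

text \<open>The factor \<open>c\<close> is quantified before \<open>t\<close>, that is, independent of \<open>q\<^sup>\<alpha>\<close>; the same holds for
  the coefficients in \<open>expandable\<close>.\<close>

definition scalar_on_v :: "U set" where
  "scalar_on_v = {X. \<exists>c. \<forall>t. t \<noteq> 0 \<longrightarrow> act t X = \<iota> c *s axis (1, 1) 1}"

lemma even_generator_v:
  assumes "g \<in> {SigmaG, QE i, QEinv i, E12, E21}"
  shows "\<exists>c. \<forall>t. t \<noteq> 0 \<longrightarrow> VV_gen \<iota> s t g *v axis (1, 1) 1 = \<iota> c *s axis (1, 1) 1"
proof -
  define c :: Cq where "c = (if g \<in> {E12, E21} then 0 else 1)"
  have "VV_gen \<iota> s t g *v axis (1, 1) 1 = \<iota> c *s axis (1, 1) 1" if "t \<noteq> 0" for t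
    using assms that exhaust_3[of i]
    by (auto simp: VV_gen_explicit c_def iota_simps kron_axis matrix_vector_mult_add_rdistrib cartan_def)
  then show ?thesis by blast
qed

sublocale even_module scalar_on_v
proof
  show "scalar_subspace scalar_on_v"
    unfolding scalar_subspace_def
  proof (intro conjI ballI allI)
    show "0 \<in> scalar_on_v"
      by (auto simp: scalar_on_v_def act_simps iota_simps intro!: exI[of _ 0])
    show "X + Y \<in> scalar_on_v" if "X \<in> scalar_on_v" "Y \<in> scalar_on_v" for X Y
    proof -
      obtain c d where "\<forall>t. t \<noteq> 0 \<longrightarrow> act t X = \<iota> c *s axis (1, 1) 1"
        "\<forall>t. t \<noteq> 0 \<longrightarrow> act t Y = \<iota> d *s axis (1, 1) 1"
        using \<open>X \<in> scalar_on_v\<close> \<open>Y \<in> scalar_on_v\<close> by (auto simp: scalar_on_v_def)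
      then show ?thesis
        by (auto simp: scalar_on_v_def act_simps iota_simps intro!: exI[of _ "c + d"])
    qed
    show "Uscal c * X \<in> scalar_on_v" if X: "X \<in> scalar_on_v" for c X
    proof -
      obtain d where "\<forall>t. t \<noteq> 0 \<longrightarrow> act t X = \<iota> d *s axis (1, 1) 1"
        using X by (auto simp: scalar_on_v_def)
      then show ?thesis
        by (auto simp: scalar_on_v_def act_simps iota_simps intro!: exI[of _ "c * d"])
    qed
  qed
  show "carries (Ugen g) scalar_on_v scalar_on_v" if g: "g \<in> {SigmaG, QE i, QEinv i, E12, E21}" for g i
    unfolding carries_def
  proof
    fix X assume "X \<in> scalar_on_v"
    then obtain d where d: "\<forall>t. t \<noteq> 0 \<longrightarrow> act t X = \<iota> d *s axis (1, 1) 1"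
      by (auto simp: scalar_on_v_def)
    obtain c where c: "\<forall>t. t \<noteq> 0 \<longrightarrow> VV_gen \<iota> s t g *v axis (1, 1) 1 = \<iota> c *s axis (1, 1) 1"
      using even_generator_v[OF g] by blast
    show "Ugen g * X \<in> scalar_on_v"
      unfolding scalar_on_v_def
      by (auto simp: act_Ugen d vec.scale c iota_simps intro!: exI[of _ "d * c"])
  qed
qed

definition expandable :: "U set" where
  "expandable =
    {X. \<exists>c. \<forall>t. t \<noteq> 0 \<longrightarrow> act t X = (\<Sum>m\<in>set B_monomials. \<iota> (c m) *s act t m)}"

lemma expandable_subspace: "scalar_subspace expandable"
  unfolding scalar_subspace_def
proof (intro conjI ballI allI)
  show "0 \<in> expandable"
    by (auto simp: expandable_def act_simps iota_simps intro!: exI[of _ "\<lambda>_. 0"])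
  show "X + Y \<in> expandable" if XY: "X \<in> expandable" "Y \<in> expandable" for X Y
  proof -
    obtain c d where "\<forall>t. t \<noteq> 0 \<longrightarrow> act t X = (\<Sum>m\<in>set B_monomials. \<iota> (c m) *s act t m)"
      "\<forall>t. t \<noteq> 0 \<longrightarrow> act t Y = (\<Sum>m\<in>set B_monomials. \<iota> (d m) *s act t m)"
      using XY by (auto simp: expandable_def)
    then show ?thesis
      by (auto simp: expandable_def act_simps iota_simps sum.distrib intro!: exI[of _ "\<lambda>m. c m + d m"])
  qed
  show "Uscal a * X \<in> expandable" if X: "X \<in> expandable" for a X
  proof -
    obtain c where "\<forall>t. t \<noteq> 0 \<longrightarrow> act t X = (\<Sum>m\<in>set B_monomials. \<iota> (c m) *s act t m)"
      using X by (auto simp: expandable_def)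
    then show ?thesis
      by (auto simp: expandable_def act_simps iota_simps vec.scale_sum_right intro!: exI[of _ "\<lambda>m. a * c m"])
  qed
qed

lemma monomial_expandable:
  assumes m: "m \<in> set B_monomials"
  shows "carries m scalar_on_v expandable"
  unfolding carries_def
proof
  fix X assume "X \<in> scalar_on_v"
  then obtain c where c: "\<And>t. t \<noteq> 0 \<Longrightarrow> act t X = \<iota> c *s axis (1, 1) 1"
    by (auto simp: scalar_on_v_def)
  define d where "d n = (if n = m then c else 0)" for n
  have "act t (m * X) = (\<Sum>n\<in>set B_monomials. \<iota> (d n) *s act t n)" if "t \<noteq> 0" for t
  proof -
    have "(\<Sum>n\<in>set B_monomials. \<iota> (d n) *s act t n) =
        (\<Sum>n\<in>set B_monomials. if n = m then \<iota> c *s act t m else 0)"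
      by (rule sum.cong) (auto simp: d_def iota_simps)
    also have "\<dots> = \<iota> c *s act t m"
      using m by simp
    also have "\<dots> = act t (m * X)"
      by (simp add: act_times[OF that] c[OF that] vec.scale) (simp add: act_def)
    finally show ?thesis ..
  qed
  then show "m * X \<in> expandable"
    unfolding expandable_def by blast
qed

text \<open>Since \<open>R4\<close> contains \<open>1\<close> and is stable under \<open>X\<close>, it contains \<open>X\<close>.\<close>

lemma expandable_UNIV: "X \<in> expandable"
proof -
  \<comment> \<open>Unwinding the four extensions leaves one goal for each of the 16 monomials.\<close>
  have "carries 1 R4 expandable"
    unfolding R_defs
    by (intro carries_extend expandable_subspace; rule monomial_expandable)
      (simp_all add: B_monomials_def)
  moreover have "1 \<in> R4"
  proof -
    have "1 \<in> scalar_on_v"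
      by (auto simp: scalar_on_v_def act_simps iota_simps intro!: exI[of _ 1])
    then show ?thesis using inclusions by blast
  qed
  then have "X * 1 \<in> R4"
    using U_stable[of X] by (auto simp: carries_def simp del: mult_1_right)
  ultimately show ?thesis by (auto simp: carries_def)
qed

lemma B_basis_act: "B_basis \<iota> s t = map (act t) B_monomials"
  by (simp add: B_basis_def act_def)

lemma expansion:
  obtains c where "\<And>t. t \<noteq> 0 \<Longrightarrow> act t X = (\<Sum>m\<in>set B_monomials. \<iota> (c m) *s act t m)"
  using expandable_UNIV[of X] by (auto simp: expandable_def)

section \<open>The 16 vectors form a basis\<close>

lemma act_in_span:
  assumes "t \<noteq> 0"
  shows "act t X \<in> vec.span (set (B_basis \<iota> s t))"
proof -
  obtain c where "act t X = (\<Sum>m\<in>set B_monomials. \<iota> (c m) *s act t m)"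
    using expansion assms by metis
  then show ?thesis
    by (simp only:) (intro vec.span_sum vec.span_scale vec.span_base, simp add: B_basis_act)
qed

lemma span_stable:
  assumes t: "t \<noteq> 0" and w: "w \<in> vec.span (set (B_basis \<iota> s t))"
  shows "VV_gen \<iota> s t g *v w \<in> vec.span (set (B_basis \<iota> s t))" (is "_ \<in> ?W")
  using w
proof (induction rule: vec.span_induct_alt)
  case base
  then show ?case by (simp add: vec.span_zero)
next
  case (step c x y)
  obtain m where "x = act t m" using step(1) by (auto simp: B_basis_act)
  then have "VV_gen \<iota> s t g *v x \<in> ?W"
    using act_in_span[OF t, of "Ugen g * m"] by (simp add: act_Ugen[OF t])
  then show ?case
    using step(2) by (simp add: matrix_vector_right_distrib vec.scale vec.span_add vec.span_scale)
qed

text \<open>Each step applies a generator to a basis tensor in the span and cancels the terms that are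
  known to lie in the span.\<close>

lemma span_B_basis:
  assumes adm: "alpha_admissible s t"
  shows "vec.span (set (B_basis \<iota> s t)) = UNIV" (is "?W = _")
proof -
  have t: "t \<noteq> 0" and nz: "qnumber (s\<^sup>2) (t\<^sup>2) \<noteq> 0" "qnumber (s\<^sup>2) (t\<^sup>2 * s\<^sup>2) \<noteq> 0"
    using adm by (auto simp: alpha_admissible_def)
  have step: "axis p 1 \<in> ?W"
    if "w \<in> ?W" "VV_gen \<iota> s t g *v w = w' + x *s axis p 1" "w' \<in> ?W" "x \<noteq> 0" for p w w' g x
  proof -
    have "x *s axis p 1 = VV_gen \<iota> s t g *v w - w'" using that(2) by simp
    then have "x *s axis p 1 \<in> ?W"
      using span_stable[OF t that(1)] that(3) by (simp only: vec.span_diff)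
    then show ?thesis using vec.span_scale[of "x *s axis p 1" _ "inverse x"] that(4) by simp
  qed
  note eval = VV_gen_explicit[OF t] kron_axis kron_plus matrix_vector_mult_add_rdistrib
  have 11: "axis (1, 1) 1 \<in> ?W"
    using act_in_span[OF t, of 1] by (simp add: act_simps[OF t])
  \<comment> \<open>Along the column of \<open>e\<^sub>1\<^sup>*\<close>, which \<open>E\<^sup>3\<^sub>2\<close> and \<open>E\<^sup>2\<^sub>1\<close> kill, only the first tensor factor moves.\<close>
  have 21: "axis (2, 1) 1 \<in> ?W"
    by (rule step[OF 11, of E32 0 "qnumber (s\<^sup>2) (t\<^sup>2) * t"]) (use t nz in \<open>simp_all add: eval vec.span_zero\<close>)
  have 31: "axis (3, 1) 1 \<in> ?W"
    by (rule step[OF 21, of E21 0 "- 1"]) (simp_all add: eval vec.span_zero)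
  have 41: "axis (4, 1) 1 \<in> ?W"
    by (rule step[OF 31, of E32 0 "qnumber (s\<^sup>2) (t\<^sup>2 * s\<^sup>2) * t"]) (use t nz in \<open>simp_all add: eval vec.span_zero\<close>)
  have col1: "axis (i, 1) 1 \<in> ?W" for i
    using 11 21 31 41 exhaust_4[of i] by auto
  \<comment> \<open>From one column to the next: the term in which the first tensor factor moves stays in a
    column already reached.\<close>
  have col2: "axis (i, 2) 1 \<in> ?W" for i
  proof (rule step[OF col1[of i], of E23 "(if i = 2 then t else 0) *s axis (1, 1) 1 + (if i = 4 then t else 0) *s axis (3, 1) 1"])
    show "VV_gen \<iota> s t E23 *v axis (i, 1) 1 =
       (if i = 2 then t else 0) *s axis (1, 1) 1 + (if i = 4 then t else 0) *s axis (3, 1) 1 +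
       (- pick4 t (- t) (- t * s) (t * s) i) *s axis (i, 2) 1"
      using exhaust_4[of i] by (auto simp: eval)
  next
    show "- pick4 t (- t) (- t * s) (t * s) i \<noteq> 0"
      using exhaust_4[of i] t s_nonzero by auto
  qed (intro vec.span_add vec.span_scale col1)
  have col3: "axis (i, 3) 1 \<in> ?W" for i
  proof (rule step[OF col2[of i], of E12 "(if i = 3 then - s else 0) *s axis (2, 2) 1"])
    show "VV_gen \<iota> s t E12 *v axis (i, 2) 1 =
       (if i = 3 then - s else 0) *s axis (2, 2) 1 +
       (inverse (s\<^sup>2) * pick4 1 s (inverse s) 1 i) *s axis (i, 3) 1"
      using exhaust_4[of i] by (auto simp: eval)
  next
    show "inverse (s\<^sup>2) * pick4 1 s (inverse s) 1 i \<noteq> 0"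
      using exhaust_4[of i] t s_nonzero by auto
  qed (intro vec.span_add vec.span_scale col2)
  have col4: "axis (i, 4) 1 \<in> ?W" for i
  proof (rule step[OF col3[of i], of E23 "(if i = 2 then t * s else 0) *s axis (1, 3) 1 + (if i = 4 then t * s else 0) *s axis (3, 3) 1"])
    show "VV_gen \<iota> s t E23 *v axis (i, 3) 1 =
       (if i = 2 then t * s else 0) *s axis (1, 3) 1 + (if i = 4 then t * s else 0) *s axis (3, 3) 1 +
       pick4 t (- t) (- t * s) (t * s) i *s axis (i, 4) 1"
      using exhaust_4[of i] by (auto simp: eval)
  next
    show "pick4 t (- t) (- t * s) (t * s) i \<noteq> 0"
      using exhaust_4[of i] t s_nonzero by auto
  qed (intro vec.span_add vec.span_scale col3)
  have "axis (i, j) 1 \<in> ?W" for i j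
    using exhaust_4[of j] by (elim disjE) (simp_all only: col1 col2 col3 col4)
  then have "cart_basis \<subseteq> ?W"
    by (auto simp: cart_basis_def split_paired_all)
  then show ?thesis
    using vec.span_mono[of cart_basis ?W] by (simp add: vec.span_span top.extremum_unique)
qed

lemma B_basis_is_basis:
  assumes adm: "alpha_admissible s t"
  shows "is_ordered_basis (B_basis \<iota> s t)"
proof -
  let ?B = "B_basis \<iota> s t"
  have len: "length ?B = 16" by (simp add: B_basis_def B_monomials_def)
  have dim: "vec.dim (UNIV :: ('k^(4 \<times> 4)) set) = 16"
    by (simp only: vec_dim_card card_prod) simp
  have "16 \<le> card (set ?B)"
    using vec.dim_le_card[of UNIV "set ?B"] span_B_basis[OF adm] dim by simp
  then have card: "card (set ?B) = 16"
    using card_length[of ?B] len by simp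
  have "vec.independent (set ?B)"
    using vec.card_le_dim_spanning[of "set ?B" UNIV] span_B_basis[OF adm] dim card by simp
  then show ?thesis
    unfolding is_ordered_basis_def
    using span_B_basis[OF adm] card len card_distinct[of ?B] by simp
qed

section \<open>The matrix coefficients\<close>

text \<open>Column \<open>j\<close> of the matrix of \<open>X\<close> is the expansion of \<open>X B\<^sub>j v\<close>. The expansion of \<open>X B\<^sub>j\<close> is indexed
  by elements of \<open>U\<close>, and its coefficient at \<open>B\<^sub>i\<close> is the one sought because the vectors \<open>B\<^sub>i v\<close>, and
  therefore the monomials, are distinct.\<close>

lemma coefficients:
  assumes "j < 16"
  shows "\<exists>c. \<forall>t. alpha_admissible s t \<longrightarrow> (\<forall>i < 16.
    coeff_in_basis (B_basis \<iota> s t) (VV_action \<iota> s t X) i j = \<iota> (c i))"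
proof -
  have len: "length B_monomials = 16" by (simp add: B_monomials_def)
  obtain c where c: "\<And>t. t \<noteq> 0 \<Longrightarrow>
      act t (X * B_monomials ! j) = (\<Sum>m\<in>set B_monomials. \<iota> (c m) *s act t m)"
    using expansion by blast
  have "coeff_in_basis (B_basis \<iota> s t) (VV_action \<iota> s t X) i j = \<iota> (c (B_monomials ! i))"
    if adm: "alpha_admissible s t" and i: "i < 16" for t i
  proof -
    let ?B = "set (B_basis \<iota> s t)"
    have t: "t \<noteq> 0" using adm by (simp add: alpha_admissible_def)
    have "distinct (B_basis \<iota> s t)" and indep: "vec.independent ?B"
      using B_basis_is_basis[OF adm] by (auto simp: is_ordered_basis_def)
    then have inj: "inj_on (act t) (set B_monomials)"
      by (simp add: B_basis_act distinct_map)
    have mem: "act t m \<in> ?B" if "m \<in> set B_monomials" for m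
      using that by (simp add: B_basis_act)
    have "coeff_in_basis (B_basis \<iota> s t) (VV_action \<iota> s t X) i j =
        vec.representation ?B (act t (X * B_monomials ! j)) (act t (B_monomials ! i))"
      using assms i by (simp add: coeff_in_basis_def B_basis_act len act_times[OF t])
    also have "\<dots> = (\<Sum>m\<in>set B_monomials. vec.representation ?B (\<iota> (c m) *s act t m) (act t (B_monomials ! i)))"
      unfolding c[OF t]
      by (subst vec.representation_sum[OF indep]) (use mem in \<open>simp_all add: vec.span_scale vec.span_base\<close>)
    also have "\<dots> = (\<Sum>m\<in>set B_monomials. if m = B_monomials ! i then \<iota> (c m) else 0)"
    proof (rule sum.cong)
      fix m assume m: "m \<in> set B_monomials"
      have "act t (B_monomials ! i) = act t m \<longleftrightarrow> B_monomials ! i = m"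
        using i len by (intro inj_on_eq_iff[OF inj _ m]) simp
      then show "vec.representation ?B (\<iota> (c m) *s act t m) (act t (B_monomials ! i)) =
          (if m = B_monomials ! i then \<iota> (c m) else 0)"
        by (auto simp: vec.representation_scale[OF indep vec.span_base[OF mem[OF m]]]
            vec.representation_basis[OF indep mem[OF m]])
    qed simp
    also have "\<dots> = \<iota> (c (B_monomials ! i))"
      using i len by simp
    finally show ?thesis .
  qed
  then show ?thesis by (intro exI[of _ "\<lambda>i. c (B_monomials ! i)"]) simp
qed

end

theorem theorem2p13:
  fixes \<iota> :: "Cq \<Rightarrow> 'k::field" and s :: 'k
  assumes "field_embedding \<iota>" and "s\<^sup>2 = \<iota> qv"
  shows "(\<forall>t. alpha_admissible s t \<longrightarrow>
            is_ordered_basis (B_basis \<iota> s t) \<and>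
            (\<forall>X. \<forall>i < 16. \<forall>j < 16.
               coeff_in_basis (B_basis \<iota> s t) (VV_action \<iota> s t X) i j \<in> range \<iota>)) \<and>
         (\<forall>t t'. alpha_admissible s t \<longrightarrow> alpha_admissible s t' \<longrightarrow>
            (\<forall>X. \<forall>i < 16. \<forall>j < 16.
               coeff_in_basis (B_basis \<iota> s t) (VV_action \<iota> s t X) i j =
               coeff_in_basis (B_basis \<iota> s t') (VV_action \<iota> s t' X) i j))"
proof -
  interpret tensor_family \<iota> s
    by unfold_locales (rule assms)+
  show ?thesis
  proof (intro conjI allI impI)
    fix t assume "alpha_admissible s t"
    then show "is_ordered_basis (B_basis \<iota> s t)" by (rule B_basis_is_basis)
  next
    fix t X and i j :: nat assume *: "alpha_admissible s t" "i < 16" "j < 16"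
    show "coeff_in_basis (B_basis \<iota> s t) (VV_action \<iota> s t X) i j \<in> range \<iota>"
      using coefficients[OF *(3), of X] *(1,2) by auto
  next
    fix t t' X and i j :: nat
    assume *: "alpha_admissible s t" "alpha_admissible s t'" "i < 16" "j < 16"
    show "coeff_in_basis (B_basis \<iota> s t) (VV_action \<iota> s t X) i j =
      coeff_in_basis (B_basis \<iota> s t') (VV_action \<iota> s t' X) i j"
      using coefficients[OF *(4), of X] *(1-3) by auto
  qed
qed

end
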